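(* Let $u:\mathbb{R}^n\to\mathbb{R}$ be smooth and let $\Sigma^n:=\{X=(x,Du(x),u-\frac12 x\cdot Du) : x\in\mathbb{R}^n\}$ be an entire Legendrian graph in $\mathbb{R}^{2n+1}$ satisfying $$H-\theta\xi=-\frac12X^\perp.$$ Let $$V:=u-\frac12x\cdot Du,\qquad f:=\frac14\left(|X|^2-\frac14V^2\right),$$ and for $r>0$ let $$D_r:=\{p\in\Sigma^n : 2\sqrt{f(p)}\le r\}.$$ Then the weighted volume of $\Sigma^n$ is finite, namely $$\int_{\Sigma^n}e^{-f}\,d\mu<+\infty,$$ and $$\mathrm{Vol}(D_r)=\int_{D_r}d\mu\le C_1r^n\qquad\text{for all } r\ge1,$$ where $C_1$ is a positive constant depending only on $\int_{\Sigma^n}e^{-f}\,d\mu$.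
   Context: $\mathbb{R}^{2n+1}$ has coordinates $(x_1,\dots,x_n,y_1,\dots,y_n,z)$, contact form $\eta=\frac12dz-\frac14\sum_{i=1}^n(y_i\,dx_i-x_i\,dy_i)$, Reeb field $\xi=2\frac{\partial}{\partial z}$, and Riemannian metric $g=\langle\cdot,\cdot\rangle=\frac14\sum_{i=1}^n(dx_i^2+dy_i^2)+\eta\otimes\eta$. The fields $E_i=2\frac{\partial}{\partial x_i}+y_i\frac{\partial}{\partial z}$, $E_{n+i}=-2\frac{\partial}{\partial y_i}+x_i\frac{\partial}{\partial z}$ ($1\le i\le n$) and $E_{2n+1}=\xi$ form an orthonormal frame, and the tensor $\phi$ is given by $\phi E_i=E_{n+i}$, $\phi E_{n+i}=-E_i$, $\phi\xi=0$. $\Sigma^n$ is Legendrian, i.e. $\eta$ vanishes on it (this is automatic for graphs of the given form), and carries the metric induced by $g$, with gradient $\nabla$ and volume element $d\mu$. $H$ is the mean curvature vector of $\Sigma^n$, i.e. the trace of its second fundamental form in $(\mathbb{R}^{2n+1},g)$. $X$ is the position vector viewed as a vector field along $\Sigma^n$: $X=\sum_i x_i\frac{\partial}{\partial x_i}+\sum_i u_i\frac{\partial}{\partial y_i}+V\frac{\partial}{\partial z}$ with $u_i=\partial u/\partial x_i$; $|X|^2=g(X,X)$, and $X^\perp$ is the $g$-orthogonal projection of $X$ to the normal space of $\Sigma^n$. With these conventions $f\ge 0$. $\theta$ is the Legendrian angle of $\Sigma^n$, $\theta=-\sum_{i=1}^n\arctan\lambda_i$ with $\lambda_i$ the eigenvalues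 of $D^2u$; it satisfies $H=\phi\nabla\theta$. Functions of $x$ such as $u,V,\theta$ are regarded as functions on $\Sigma^n$ via the graph parametrization. *)

theory Defs
  imports
    "HOL-Analysis.Analysis"
    "Jordan_Normal_Form.Char_Poly"
    "Jordan_Normal_Form.Gauss_Jordan_Elimination"
begin

text \<open>
  The constant in the theorem must not depend on the dimension, so \<open>n\<close> is a natural number
  quantified inside the formula.  A point of \<open>R^m\<close> is a function \<^typ>\<open>nat \<Rightarrow> real\<close> in
  \<open>{..<m} \<rightarrow>\<^sub>E UNIV\<close>, which is both \<open>topspace (powertop_real {..<m})\<close> and the space of
  \<open>\<Pi>\<^sub>M i\<in>{..<m}. lborel\<close>.  Of a tangent vector at such a point only the components with index below
  \<open>m\<close> are relevant.  Indices start at 0; in \<open>R^(2n+1)\<close> the coordinates \<open>x_i\<close>, \<open>y_i\<close>, \<open>z\<close> have the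
  indices \<open>i\<close>, \<open>n + i\<close> (\<open>i < n\<close>) and \<open>2n\<close>.
\<close>

definition partial_deriv :: "nat \<Rightarrow> ((nat \<Rightarrow> real) \<Rightarrow> real) \<Rightarrow> (nat \<Rightarrow> real) \<Rightarrow> real" where
  "partial_deriv i u x = deriv (\<lambda>t. u (x(i := t))) (x i)"

text \<open>All iterated partial derivatives exist and are continuous.\<close>

definition smooth_Rn :: "nat \<Rightarrow> ((nat \<Rightarrow> real) \<Rightarrow> real) \<Rightarrow> bool" where
  "smooth_Rn n u \<longleftrightarrow>
     (\<forall>js. set js \<subseteq> {..<n} \<longrightarrow>
        continuous_map (powertop_real {..<n}) euclideanreal (foldr partial_deriv js u) \<and>
        (\<forall>i<n. \<forall>x\<in>{..<n} \<rightarrow>\<^sub>E UNIV.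
           (\<lambda>t. foldr partial_deriv js u (x(i := t))) differentiable at (x i)))"


subsection \<open>The contact metric space \<open>R^(2n+1)\<close>\<close>

definition contact_form :: "nat \<Rightarrow> (nat \<Rightarrow> real) \<Rightarrow> (nat \<Rightarrow> real) \<Rightarrow> real" where
  "contact_form n p v = v (2 * n) / 2 - (\<Sum>i<n. p (n + i) * v i - p i * v (n + i)) / 4"

definition reeb :: "nat \<Rightarrow> nat \<Rightarrow> real" where
  "reeb n a = (if a = 2 * n then 2 else 0)"

definition contact_metric :: "nat \<Rightarrow> (nat \<Rightarrow> real) \<Rightarrow> (nat \<Rightarrow> real) \<Rightarrow> (nat \<Rightarrow> real) \<Rightarrow> real" where
  "contact_metric n p v w =
     (\<Sum>i<n. v i * w i + v (n + i) * w (n + i)) / 4 + contact_form n p v * contact_form n p w"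

definition metric_coeff :: "nat \<Rightarrow> nat \<Rightarrow> nat \<Rightarrow> (nat \<Rightarrow> real) \<Rightarrow> real" where
  "metric_coeff n a b p = contact_metric n p (\<lambda>c. of_bool (c = a)) (\<lambda>c. of_bool (c = b))"

definition metric_inverse :: "nat \<Rightarrow> (nat \<Rightarrow> real) \<Rightarrow> real mat" where
  "metric_inverse n p =
     the (mat_inverse (mat (2*n+1) (2*n+1) (\<lambda>(a, b). metric_coeff n a b p)))"

text \<open>\<open>christoffel n p c a b\<close> is the symbol with upper index \<open>c\<close> and lower indices \<open>a\<close>, \<open>b\<close> of the
  Levi-Civita connection of the metric.\<close>

definition christoffel :: "nat \<Rightarrow> (nat \<Rightarrow> real) \<Rightarrow> nat \<Rightarrow> nat \<Rightarrow> nat \<Rightarrow> real" where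
  "christoffel n p c a b =
     (\<Sum>d<2*n+1. metric_inverse n p $$ (c, d) *
        (partial_deriv a (metric_coeff n b d) p + partial_deriv b (metric_coeff n a d) p
          - partial_deriv d (metric_coeff n a b) p)) / 2"


subsection \<open>The graph of \<open>u\<close> and its extrinsic geometry\<close>

definition potential :: "nat \<Rightarrow> ((nat \<Rightarrow> real) \<Rightarrow> real) \<Rightarrow> (nat \<Rightarrow> real) \<Rightarrow> real" where
  "potential n u x = u x - (\<Sum>i<n. x i * partial_deriv i u x) / 2"

definition graph_map :: "nat \<Rightarrow> ((nat \<Rightarrow> real) \<Rightarrow> real) \<Rightarrow> (nat \<Rightarrow> real) \<Rightarrow> nat \<Rightarrow> real" where
  "graph_map n u x = (\<lambda>a\<in>{..<2*n+1}.
     if a < n then x a else if a < 2*n then partial_deriv (a - n) u x else potential n u x)"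

definition legendrian_graph :: "nat \<Rightarrow> ((nat \<Rightarrow> real) \<Rightarrow> real) \<Rightarrow> (nat \<Rightarrow> real) set" where
  "legendrian_graph n u = graph_map n u ` ({..<n} \<rightarrow>\<^sub>E UNIV)"

definition tangent :: "nat \<Rightarrow> ((nat \<Rightarrow> real) \<Rightarrow> real) \<Rightarrow> nat \<Rightarrow> (nat \<Rightarrow> real) \<Rightarrow> nat \<Rightarrow> real" where
  "tangent n u i x a = partial_deriv i (\<lambda>y. graph_map n u y a) x"

definition induced_metric :: "nat \<Rightarrow> ((nat \<Rightarrow> real) \<Rightarrow> real) \<Rightarrow> (nat \<Rightarrow> real) \<Rightarrow> real mat" where
  "induced_metric n u x =
     mat n n (\<lambda>(i, j). contact_metric n (graph_map n u x) (tangent n u i x) (tangent n u j x))"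

definition induced_inverse :: "nat \<Rightarrow> ((nat \<Rightarrow> real) \<Rightarrow> real) \<Rightarrow> (nat \<Rightarrow> real) \<Rightarrow> real mat" where
  "induced_inverse n u x = the (mat_inverse (induced_metric n u x))"

text \<open>The orthogonal projection of a vector at \<open>graph_map n u x\<close> to the normal space.\<close>

definition normal_part ::
  "nat \<Rightarrow> ((nat \<Rightarrow> real) \<Rightarrow> real) \<Rightarrow> (nat \<Rightarrow> real) \<Rightarrow> (nat \<Rightarrow> real) \<Rightarrow> nat \<Rightarrow> real" where
  "normal_part n u x v a =
     v a - (\<Sum>i<n. \<Sum>j<n. induced_inverse n u x $$ (i, j) *
              contact_metric n (graph_map n u x) v (tangent n u i x) * tangent n u j x a)"

text \<open>The ambient covariant derivative of the \<open>j\<close>-th coordinate tangent field along the \<open>i\<close>-th.\<close>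

definition cov_deriv_tangent ::
  "nat \<Rightarrow> ((nat \<Rightarrow> real) \<Rightarrow> real) \<Rightarrow> nat \<Rightarrow> nat \<Rightarrow> (nat \<Rightarrow> real) \<Rightarrow> nat \<Rightarrow> real" where
  "cov_deriv_tangent n u i j x a =
     partial_deriv i (\<lambda>y. tangent n u j y a) x
     + (\<Sum>b<2*n+1. \<Sum>c<2*n+1.
          christoffel n (graph_map n u x) a b c * tangent n u i x b * tangent n u j x c)"

definition second_fundamental_form ::
  "nat \<Rightarrow> ((nat \<Rightarrow> real) \<Rightarrow> real) \<Rightarrow> nat \<Rightarrow> nat \<Rightarrow> (nat \<Rightarrow> real) \<Rightarrow> nat \<Rightarrow> real" where
  "second_fundamental_form n u i j x = normal_part n u x (cov_deriv_tangent n u i j x)"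

definition mean_curvature ::
  "nat \<Rightarrow> ((nat \<Rightarrow> real) \<Rightarrow> real) \<Rightarrow> (nat \<Rightarrow> real) \<Rightarrow> nat \<Rightarrow> real" where
  "mean_curvature n u x a =
     (\<Sum>i<n. \<Sum>j<n. induced_inverse n u x $$ (i, j) * second_fundamental_form n u i j x a)"

definition hessian :: "nat \<Rightarrow> ((nat \<Rightarrow> real) \<Rightarrow> real) \<Rightarrow> (nat \<Rightarrow> real) \<Rightarrow> real mat" where
  "hessian n u x = mat n n (\<lambda>(i, j). partial_deriv i (partial_deriv j u) x)"

text \<open>Eigenvalues are counted with their multiplicity.\<close>

definition legendrian_angle :: "nat \<Rightarrow> ((nat \<Rightarrow> real) \<Rightarrow> real) \<Rightarrow> (nat \<Rightarrow> real) \<Rightarrow> real" where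
  "legendrian_angle n u x =
     - (\<Sum>l | eigenvalue (hessian n u x) l.
          real (order l (char_poly (hessian n u x))) * arctan l)"

text \<open>The position vector field has at \<open>p\<close> the components of \<open>p\<close> itself, hence the last
  argument of \<^const>\<open>normal_part\<close>.\<close>

definition shrinker_equation :: "nat \<Rightarrow> ((nat \<Rightarrow> real) \<Rightarrow> real) \<Rightarrow> bool" where
  "shrinker_equation n u \<longleftrightarrow>
     (\<forall>x\<in>{..<n} \<rightarrow>\<^sub>E UNIV. \<forall>a<2*n+1.
        mean_curvature n u x a - legendrian_angle n u x * reeb n a
          = - (1/2) * normal_part n u x (graph_map n u x) a)"


subsection \<open>Weighted volume\<close>

text \<open>The Riemannian volume of the graph as a measure on \<open>R^(2n+1)\<close> concentrated on the graph.\<close>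

definition graph_volume :: "nat \<Rightarrow> ((nat \<Rightarrow> real) \<Rightarrow> real) \<Rightarrow> (nat \<Rightarrow> real) measure" where
  "graph_volume n u =
     distr (density (\<Pi>\<^sub>M i\<in>{..<n}. lborel)
              (\<lambda>x. ennreal (sqrt (Determinant.det (induced_metric n u x)))))
           (\<Pi>\<^sub>M a\<in>{..<2*n+1}. borel) (graph_map n u)"

text \<open>For \<open>p\<close> on the graph, \<open>restrict p {..<n}\<close> is the parameter \<open>x\<close> with \<open>p = graph_map n u x\<close>.\<close>

definition weight_fun :: "nat \<Rightarrow> ((nat \<Rightarrow> real) \<Rightarrow> real) \<Rightarrow> (nat \<Rightarrow> real) \<Rightarrow> real" where
  "weight_fun n u p =
     1/4 * (contact_metric n p p p - 1/4 * (potential n u (restrict p {..<n}))\<^sup>2)"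

definition sublevel :: "nat \<Rightarrow> ((nat \<Rightarrow> real) \<Rightarrow> real) \<Rightarrow> real \<Rightarrow> (nat \<Rightarrow> real) set" where
  "sublevel n u r = {p \<in> legendrian_graph n u. 2 * sqrt (weight_fun n u p) \<le> r}"


subsection \<open>The graph is Legendrian\<close>

lemma partial_deriv_eqI:
  assumes "((\<lambda>t. u (x(i := t))) has_real_derivative D) (at (x i))"
  shows "partial_deriv i u x = D"
  using assms unfolding partial_deriv_def by (rule DERIV_imp_deriv)

lemma smooth_Rn_has_derivative:
  assumes "smooth_Rn n u" "set js \<subseteq> {..<n}" "i < n" "x \<in> {..<n} \<rightarrow>\<^sub>E UNIV"
  shows "((\<lambda>t. foldr partial_deriv js u (x(i := t))) has_real_derivative
           partial_deriv i (foldr partial_deriv js u) x) (at (x i))"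
  using assms unfolding smooth_Rn_def partial_deriv_def
  by (simp add: DERIV_deriv_iff_real_differentiable)

lemma graph_is_legendrian:
  assumes u: "smooth_Rn n u" and x: "x \<in> {..<n} \<rightarrow>\<^sub>E UNIV" and i: "i < n"
  shows "contact_form n (graph_map n u x) (tangent n u i x) = 0"
proof -
  have D1: "((\<lambda>t. u (x(i := t))) has_real_derivative partial_deriv i u x) (at (x i))"
    using smooth_Rn_has_derivative[OF u, of "[]"] x i by simp
  have D2: "((\<lambda>t. partial_deriv j u (x(i := t))) has_real_derivative
      partial_deriv i (partial_deriv j u) x) (at (x i))" if "j < n" for j
    using smooth_Rn_has_derivative[OF u, of "[j]"] x i that by simp
  have tx: "tangent n u i x j = of_bool (j = i)" if "j < n" for j
    unfolding tangent_def graph_map_def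
    by (rule partial_deriv_eqI) (use that in \<open>auto intro!: derivative_eq_intros\<close>)
  have ty: "tangent n u i x (n + j) = partial_deriv i (partial_deriv j u) x" if "j < n" for j
    unfolding tangent_def graph_map_def
    by (rule partial_deriv_eqI) (use that D2[OF that] in auto)
  have D3: "((\<lambda>t. (x(i := t)) j) has_real_derivative of_bool (j = i)) (at (x i))" for j
    by (cases "j = i") auto
  have D4: "((\<lambda>t. (x(i := t)) j * partial_deriv j u (x(i := t))) has_real_derivative
      of_bool (j = i) * partial_deriv j u x + x j * partial_deriv i (partial_deriv j u) x)
      (at (x i))" if "j < n" for j
    using DERIV_mult[OF D3[of j] D2[OF that]] by (simp add: algebra_simps)
  have D5: "((\<lambda>t. \<Sum>j<n. (x(i := t)) j * partial_deriv j u (x(i := t))) has_real_derivative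
      (\<Sum>j<n. of_bool (j = i) * partial_deriv j u x + x j * partial_deriv i (partial_deriv j u) x))
      (at (x i))"
    by (rule DERIV_sum) (use D4 in auto)
  have tz: "tangent n u i x (2 * n) = partial_deriv i u x -
      (\<Sum>j<n. of_bool (j = i) * partial_deriv j u x + x j * partial_deriv i (partial_deriv j u) x) / 2"
  proof -
    have "((\<lambda>t. potential n u (x(i := t))) has_real_derivative partial_deriv i u x -
      (\<Sum>j<n. of_bool (j = i) * partial_deriv j u x + x j * partial_deriv i (partial_deriv j u) x) / 2)
      (at (x i))"
      unfolding potential_def by (intro DERIV_diff DERIV_cdivide D1 D5)
    then show ?thesis
      unfolding tangent_def graph_map_def by (intro partial_deriv_eqI) simp
  qed
  have s: "(\<Sum>j<n. of_bool (j = i) * partial_deriv j u x) = partial_deriv i u x"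
    using i by (simp add: of_bool_def if_distrib[of "\<lambda>c. c * _"] sum.delta cong: if_cong)
  have "(\<Sum>j<n. graph_map n u x (n + j) * tangent n u i x j - graph_map n u x j * tangent n u i x (n + j))
      = (\<Sum>j<n. of_bool (j = i) * partial_deriv j u x - x j * partial_deriv i (partial_deriv j u) x)"
    by (rule sum.cong) (auto simp: tx ty graph_map_def)
  then show ?thesis
    unfolding contact_form_def
    by (simp only: tz sum.distrib sum_subtractf s) (simp add: field_simps)
qed

end

theory Submission
  imports Defs "HOL-Probability.Probability"
begin

text \<open>
  The graph is rigid, as for entire Lagrangian self-shrinking graphs (Chau, Chen, Yuan).  The vertical
  part of the shrinker equation reads \<open>V = 4 \<theta>\<close>, so \<open>V\<close> is bounded, and the horizontal part says
  that the gradient of \<open>V\<close> is minus the trace of the third derivatives of \<open>u\<close> with respect to the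
  induced metric.  Differentiating \<open>V = u - x \<cdot> Du / 2\<close> twice turns this into
  \<open>g\<^sup>i\<^sup>j V\<^sub>i\<^sub>j = x \<cdot> DV / 2\<close>.  A barrier that is strict outside the origin and grows at infinity
  shows that the bounded solution \<open>V\<close> is largest, and likewise smallest, at the origin; so \<open>V\<close> is
  constant.  Hence \<open>Du\<close> is homogeneous of degree one and therefore linear, the volume density is
  constant, \<open>f\<close> is a quadratic form with \<open>f \<ge> |x|\<^sup>2 / 16\<close>, and the sets \<open>D\<^sub>r\<close> are dilates of
  \<open>D\<^sub>1\<close>, on which \<open>e\<^sup>-\<^sup>f\<close> is at least \<open>1/2\<close>.
\<close>

subsection \<open>Calculus with partial derivatives\<close>

text \<open>Nothing bounds the Hessian of u in advance, so the inverse induced metric may degenerate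
  at infinity and the Liouville step has no uniform ellipticity at its disposal. What holds globally
  is an upper bound: the metric is (I + (D^2 u)^2) / 4, hence at least I / 4, and its inverse has
  trace at most 4n. So the drift x . DV / 2 beats the trace term of a radial barrier once |x|^2 >
  8n, and ellipticity matters only on a compact region, where it holds with some unspecified
  constant. At the origin the drift vanishes and the barrier fails, which is why V is compared with
  its value there. The curvature is never computed: a covector that annihilates the tangent space
  removes every normal projection from the shrinker equation, and Christoffel terms vanish on pairs
  of vectors in the kernel of the contact form, so the ambient inverse metric stays abstract. The
  constant is free of n because dilation gives Vol(D_r) = r^n Vol(D_1), and Markov's inequality
  bounds Vol(D_1) by twice the weighted volume in every dimension.\<close>

lemma tendsto_powertop_real:
  fixes f :: "(nat \<Rightarrow> real) \<Rightarrow> real"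
  assumes f: "continuous_map (powertop_real {..<n}) euclideanreal f"
    and l: "l \<in> {..<n} \<rightarrow>\<^sub>E UNIV"
    and g: "\<And>s. g s \<in> {..<n} \<rightarrow>\<^sub>E UNIV"
    and lim: "\<And>i. i < n \<Longrightarrow> ((\<lambda>s. g s i) \<longlongrightarrow> l i) F"
  shows "((\<lambda>s. f (g s)) \<longlongrightarrow> f l) F"
proof -
  have "limitin (powertop_real {..<n}) g l F"
    using l g lim by (auto simp: limitin_componentwise PiE_def)
  from continuous_map_limit[OF f this] show ?thesis by (simp add: o_def)
qed

lemma line_mem: "(\<lambda>i\<in>{..<n}. h i) \<in> {..<n} \<rightarrow>\<^sub>E UNIV"
  by auto

lemma upd_mem: "x \<in> {..<n} \<rightarrow>\<^sub>E UNIV \<Longrightarrow> i < n \<Longrightarrow> x(i := t) \<in> {..<n} \<rightarrow>\<^sub>E UNIV"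
  by (auto simp: PiE_def extensional_def)

text \<open>The form of the conclusion covers both orders of \<open>s\<close> and \<open>t\<close>
  as well as equality, so that intermediate points can be squeezed as \<open>s\<close> tends to
  \<open>t\<close>.\<close>

lemma mean_value_between:
  fixes g g' :: "real \<Rightarrow> real"
  assumes "\<And>t. (g has_real_derivative g' t) (at t)"
  shows "\<exists>c. \<bar>c - t\<bar> \<le> \<bar>s - t\<bar> \<and> g s - g t = (s - t) * g' c"
proof -
  consider "s < t" | "s = t" | "t < s" by linarith
  then show ?thesis
  proof cases
    case 1
    from MVT2[OF 1, of g g'] assms obtain c where "s < c" "c < t" "g t - g s = (t - s) * g' c"
      by blast
    then show ?thesis by (intro exI[of _ c]) (auto simp: algebra_simps)
  next
    case 2
    then show ?thesis by auto
  next
    case 3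
    from MVT2[OF 3, of g g'] assms obtain c where "t < c" "c < s" "g s - g t = (s - t) * g' c"
      by blast
    then show ?thesis by (intro exI[of _ c]) auto
  qed
qed

text \<open>The coordinates are moved from \<open>z + t v\<close> to \<open>z + s v\<close> one at a time, and the mean value
  theorem is applied to each step.\<close>

lemma DERIV_along_line:
  fixes f :: "(nat \<Rightarrow> real) \<Rightarrow> real" and F :: "nat \<Rightarrow> (nat \<Rightarrow> real) \<Rightarrow> real"
  assumes cont: "\<And>i. i < n \<Longrightarrow> continuous_map (powertop_real {..<n}) euclideanreal (F i)"
    and der: "\<And>i x. i < n \<Longrightarrow> x \<in> {..<n} \<rightarrow>\<^sub>E UNIV \<Longrightarrow>
      ((\<lambda>t. f (x(i := t))) has_real_derivative F i x) (at (x i))"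
  shows "((\<lambda>t. f (\<lambda>i\<in>{..<n}. z i + t * v i)) has_real_derivative
    (\<Sum>i<n. v i * F i (\<lambda>i\<in>{..<n}. z i + t * v i))) (at t)"
proof -
  define L where "L = (\<lambda>t. \<lambda>i\<in>{..<n}. z i + t * v i)"
  define P where "P = (\<lambda>k s. \<lambda>i\<in>{..<n}. z i + (if i < k then s else t) * v i)"
  have mem: "P k s \<in> {..<n} \<rightarrow>\<^sub>E UNIV" "L s \<in> {..<n} \<rightarrow>\<^sub>E UNIV" for k s
    by (auto simp: P_def L_def)
  have step: "\<exists>c. \<bar>c - t\<bar> \<le> \<bar>s - t\<bar> \<and> f (P (Suc k) s) - f (P k s)
      = (s - t) * (v k * F k ((P k s)(k := z k + c * v k)))" if k: "k < n" for k s
  proof -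
    let ?g = "\<lambda>c. f ((P k s)(k := z k + c * v k))"
    have "(?g has_real_derivative v k * F k ((P k s)(k := z k + c * v k))) (at c)" for c
    proof -
      let ?x = "(P k s)(k := z k + c * v k)"
      have x: "?x \<in> {..<n} \<rightarrow>\<^sub>E UNIV" using upd_mem[OF mem(1) k] .
      have d: "((\<lambda>t. f ((P k s)(k := t))) has_real_derivative F k ?x) (at (z k + c * v k))"
        using der[OF k x] by simp
      have l: "((\<lambda>c. z k + c * v k) has_real_derivative v k) (at c)"
        by (auto intro!: derivative_eq_intros)
      show ?thesis using DERIV_chain2[OF d l] by (simp add: mult.commute)
    qed
    from mean_value_between[of ?g, OF this, of t s] obtain c
      where c: "\<bar>c - t\<bar> \<le> \<bar>s - t\<bar>" "?g s - ?g t
        = (s - t) * (v k * F k ((P k s)(k := z k + c * v k)))" by blast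
    have "(P k s)(k := z k + s * v k) = P (Suc k) s" "(P k s)(k := z k + t * v k) = P k s"
      using k by (auto simp: P_def fun_eq_iff)
    with c show ?thesis by auto
  qed
  then obtain c where c: "\<And>k s. k < n \<Longrightarrow> \<bar>c k s - t\<bar> \<le> \<bar>s - t\<bar>"
    and eq: "\<And>k s. k < n \<Longrightarrow> f (P (Suc k) s) - f (P k s)
      = (s - t) * (v k * F k ((P k s)(k := z k + c k s * v k)))"
    by metis
  have c_lim: "(c k \<longlongrightarrow> t) (at t)" if "k < n" for k
  proof -
    have "((\<lambda>s. c k s - t) \<longlongrightarrow> 0) (at t)"
    proof (rule Lim_null_comparison[where g = "\<lambda>s. \<bar>s - t\<bar>"])
      show "((\<lambda>s. \<bar>s - t\<bar>) \<longlongrightarrow> 0) (at t)" by (auto intro!: tendsto_eq_intros)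
    qed (use c[OF that] in auto)
    then show ?thesis using Lim_null by blast
  qed
  \<comment> \<open>Continuity of the partial derivatives enters here: the intermediate points of
    every step converge to the same point \<open>L t\<close>.\<close>
  have lim: "((\<lambda>s. F k ((P k s)(k := z k + c k s * v k))) \<longlongrightarrow> F k (L t)) (at t)" if k: "k < n" for k
  proof (rule tendsto_powertop_real[OF cont[OF k] mem(2) upd_mem[OF mem(1) k]])
    fix i assume i: "i < n"
    show "((\<lambda>s. ((P k s)(k := z k + c k s * v k)) i) \<longlongrightarrow> L t i) (at t)"
      using i by (cases "i = k"; cases "i < k")
        (auto simp: P_def L_def intro!: tendsto_eq_intros c_lim)
  qed
  have "((\<lambda>s. \<Sum>k<n. v k * F k ((P k s)(k := z k + c k s * v k))) \<longlongrightarrow> (\<Sum>k<n. v k * F k (L t))) (at t)"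
    by (intro tendsto_sum tendsto_mult tendsto_const lim) auto
  moreover have "(f (L s) - f (L t)) / (s - t) = (\<Sum>k<n. v k * F k ((P k s)(k := z k + c k s * v k)))"
    if "s \<noteq> t" for s
  proof -
    have "P n s = L s" "P 0 s = L t" by (auto simp: P_def L_def)
    then have "f (L s) - f (L t) = (\<Sum>k<n. f (P (Suc k) s) - f (P k s))"
      using sum_lessThan_telescope[of "\<lambda>k. f (P k s)" n] by simp
    also have "\<dots> = (s - t) * (\<Sum>k<n. v k * F k ((P k s)(k := z k + c k s * v k)))"
      by (simp add: sum_distrib_left eq)
    finally show ?thesis using that by simp
  qed
  ultimately have "((\<lambda>s. (f (L s) - f (L t)) / (s - t)) \<longlongrightarrow> (\<Sum>k<n. v k * F k (L t))) (at t)"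
    by (elim Lim_transform_eventually) (simp add: eventually_at_filter)
  then show ?thesis
    unfolding has_field_derivative_iff L_def by simp
qed

text \<open>The mean value theorem is applied first in s to the difference F(s, b + h) - F(s, b),
  then in t to \<open>Fx p\<close>. The left-hand side is symmetric in the two variables, which is
  what the symmetry of second derivatives rests on.\<close>

lemma second_difference:
  fixes F Fx Fxy :: "real \<Rightarrow> real \<Rightarrow> real"
  assumes x: "\<And>s t. ((\<lambda>s. F s t) has_real_derivative Fx s t) (at s)"
    and xy: "\<And>s t. ((\<lambda>t. Fx s t) has_real_derivative Fxy s t) (at t)"
  shows "\<exists>p q. \<bar>p - a\<bar> \<le> \<bar>h\<bar> \<and> \<bar>q - b\<bar> \<le> \<bar>h\<bar> \<and>
    F (a + h) (b + h) - F (a + h) b - F a (b + h) + F a b = h * h * Fxy p q"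
proof -
  have "((\<lambda>s. F s (b + h) - F s b) has_real_derivative Fx s (b + h) - Fx s b) (at s)" for s
    by (intro DERIV_diff x)
  from mean_value_between[of "\<lambda>s. F s (b + h) - F s b" "\<lambda>s. Fx s (b + h) - Fx s b", OF this, of a "a + h"]
  obtain p where p: "\<bar>p - a\<bar> \<le> \<bar>h\<bar>"
    "(F (a + h) (b + h) - F (a + h) b) - (F a (b + h) - F a b) = h * (Fx p (b + h) - Fx p b)"
    by auto
  from mean_value_between[of "Fx p" "Fxy p", OF xy, of b "b + h"]
  obtain q where q: "\<bar>q - b\<bar> \<le> \<bar>h\<bar>" "Fx p (b + h) - Fx p b = h * Fxy p q"
    by auto
  with p show ?thesis by (intro exI[of _ p] exI[of _ q]) (auto simp: algebra_simps)
qed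

text \<open>Schwarz's theorem: the same mixed difference over a square of side h equals h^2 times
  either mixed derivative, each at some point of the square; divide by h^2 and let h tend to
  0.\<close>

lemma partial_deriv_commute:
  assumes u: "smooth_Rn n u" and x: "x \<in> {..<n} \<rightarrow>\<^sub>E UNIV" and i: "i < n" and j: "j < n"
  shows "partial_deriv i (partial_deriv j u) x = partial_deriv j (partial_deriv i u) x"
proof (cases "i = j")
  case False
  let ?p = "\<lambda>s t. x(i := s, j := t)"
  have mem: "?p s t \<in> {..<n} \<rightarrow>\<^sub>E UNIV" for s t
    using upd_mem[OF upd_mem[OF x i] j] .
  have d: "((\<lambda>t. u (y(k := t))) has_real_derivative partial_deriv k u y) (at (y k))"
    if "y \<in> {..<n} \<rightarrow>\<^sub>E UNIV" "k < n" for y k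
    using smooth_Rn_has_derivative[OF u, of "[]"] that by simp
  have d2: "((\<lambda>t. partial_deriv l u (y(k := t))) has_real_derivative
      partial_deriv k (partial_deriv l u) y) (at (y k))"
    if "y \<in> {..<n} \<rightarrow>\<^sub>E UNIV" "k < n" "l < n" for y k l
    using smooth_Rn_has_derivative[OF u, of "[l]"] that by simp
  have swap: "?p s t = x(j := t, i := s)" for s t
    using False by (rule fun_upd_twist)
  have xi: "((\<lambda>s. f (?p s t)) has_real_derivative D) (at s)"
    if "((\<lambda>s'. f ((?p s t)(i := s'))) has_real_derivative D) (at (?p s t i))" for f D s t
    using that False by (simp add: swap)
  have xj: "((\<lambda>t. f (?p s t)) has_real_derivative D) (at t)"
    if "((\<lambda>t'. f ((?p s t)(j := t'))) has_real_derivative D) (at (?p s t j))" for f D s t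
    using that by simp
  have cont: "continuous_map (powertop_real {..<n}) euclideanreal (partial_deriv k (partial_deriv l u))"
    if "k < n" "l < n" for k l
    using u that unfolding smooth_Rn_def by (auto dest!: spec[of _ "[k, l]"])
  have conv: "((\<lambda>h. partial_deriv k (partial_deriv l u) (?p (p h) (q h))) \<longlongrightarrow>
      partial_deriv k (partial_deriv l u) x) (at 0)"
    if k: "k < n" "l < n" and p: "\<And>h. \<bar>p h - x i\<bar> \<le> \<bar>h\<bar>" and q: "\<And>h. \<bar>q h - x j\<bar> \<le> \<bar>h\<bar>"
    for k l and p q :: "real \<Rightarrow> real"
  proof (rule tendsto_powertop_real[OF cont[OF k] x mem])
    have z: "((\<lambda>h::real. \<bar>h\<bar>) \<longlongrightarrow> 0) (at 0)" by (auto intro!: tendsto_eq_intros)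
    have "(p \<longlongrightarrow> x i) (at 0)" "(q \<longlongrightarrow> x j) (at 0)"
      using Lim_null_comparison[OF _ z, of "\<lambda>h. p h - x i"]
        Lim_null_comparison[OF _ z, of "\<lambda>h. q h - x j"] p q
      by (auto simp: Lim_null[of p] Lim_null[of q])
    then show "((\<lambda>h. ?p (p h) (q h) m) \<longlongrightarrow> x m) (at 0)" for m
      using False by (cases "m = i"; cases "m = j") auto
  qed
  let ?D = "\<lambda>h. u (?p (x i + h) (x j + h)) - u (?p (x i + h) (x j)) - u (?p (x i) (x j + h)) + u (?p (x i) (x j))"
  have "\<exists>p q. \<bar>p - x i\<bar> \<le> \<bar>h\<bar> \<and> \<bar>q - x j\<bar> \<le> \<bar>h\<bar> \<and>
      ?D h = h * h * partial_deriv j (partial_deriv i u) (?p p q)" for h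
    by (rule second_difference[of "\<lambda>s t. u (?p s t)" "\<lambda>s t. partial_deriv i u (?p s t)"])
      (intro xi xj d d2 mem i j)+
  then obtain p q where pq: "\<And>h. \<bar>p h - x i\<bar> \<le> \<bar>h\<bar>" "\<And>h. \<bar>q h - x j\<bar> \<le> \<bar>h\<bar>"
    "\<And>h. ?D h = h * h * partial_deriv j (partial_deriv i u) (?p (p h) (q h))"
    by metis
  \<comment> \<open>The same difference with the roles of the variables exchanged; only its two
    middle terms have changed places.\<close>
  have "\<exists>q p. \<bar>q - x j\<bar> \<le> \<bar>h\<bar> \<and> \<bar>p - x i\<bar> \<le> \<bar>h\<bar> \<and>
      u (?p (x i + h) (x j + h)) - u (?p (x i) (x j + h)) - u (?p (x i + h) (x j)) + u (?p (x i) (x j))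
        = h * h * partial_deriv i (partial_deriv j u) (?p p q)" for h
    by (rule second_difference[of "\<lambda>t s. u (?p s t)" "\<lambda>t s. partial_deriv j u (?p s t)"])
      (intro xi xj d d2 mem i j)+
  then obtain p' q' where pq': "\<And>h. \<bar>p' h - x i\<bar> \<le> \<bar>h\<bar>" "\<And>h. \<bar>q' h - x j\<bar> \<le> \<bar>h\<bar>"
    "\<And>h. u (?p (x i + h) (x j + h)) - u (?p (x i) (x j + h)) - u (?p (x i + h) (x j)) + u (?p (x i) (x j))
        = h * h * partial_deriv i (partial_deriv j u) (?p (p' h) (q' h))"
    by metis
  have "partial_deriv i (partial_deriv j u) (?p (p' h) (q' h)) =
      partial_deriv j (partial_deriv i u) (?p (p h) (q h))" if "h \<noteq> 0" for h
  proof -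
    have "h * h * partial_deriv i (partial_deriv j u) (?p (p' h) (q' h)) =
      h * h * partial_deriv j (partial_deriv i u) (?p (p h) (q h))"
      using pq(3)[of h] pq'(3)[of h] by linarith
    then show ?thesis using that by simp
  qed
  then have "((\<lambda>h. partial_deriv j (partial_deriv i u) (?p (p h) (q h))) \<longlongrightarrow>
      partial_deriv i (partial_deriv j u) x) (at 0)"
    by (intro Lim_transform_eventually[OF conv[OF i j pq'(1,2)]]) (simp add: eventually_at_filter)
  from tendsto_unique[OF _ this conv[OF j i pq(1,2)]] show ?thesis
    by simp
qed simp

subsection \<open>The two components of the shrinker equation\<close>

lemma sum_of_bool_mult [simp]:
  fixes f :: "nat \<Rightarrow> real"
  assumes "i < n"
  shows "(\<Sum>j<n. of_bool (j = i) * f j) = f i" "(\<Sum>j<n. of_bool (i = j) * f j) = f i"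
    "(\<Sum>j<n. f j * of_bool (j = i)) = f i" "(\<Sum>j<n. f j * of_bool (i = j)) = f i"
  using assms by (simp_all add: of_bool_def if_distrib[of "\<lambda>c. c * _"] if_distrib[of "\<lambda>c. _ * c"]
      sum.delta sum.delta' cong: if_cong)

text \<open>The contact form is linear in the base point with antisymmetric coefficients, so a
  Christoffel symbol paired with two vectors picks up a factor that is the contact form of one of
  them.\<close>

lemma contact_form_sum:
  "contact_form n p v = (\<Sum>b<2*n+1. contact_form n p (\<lambda>c. of_bool (c = b)) * v b)"
proof -
  have "contact_form n p (\<lambda>c. of_bool (c = b)) * v b = of_bool (2 * n = b) * v b / 2
      - (\<Sum>i<n. p (n + i) * (of_bool (i = b) * v b) - p i * (of_bool (n + i = b) * v b)) / 4" for b
    unfolding contact_form_def left_diff_distrib times_divide_eq_left sum_distrib_right mult.assoc ..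
  then have "(\<Sum>b<2*n+1. contact_form n p (\<lambda>c. of_bool (c = b)) * v b)
      = (\<Sum>b<2*n+1. of_bool (2 * n = b) * v b) / 2
        - (\<Sum>b<2*n+1. \<Sum>i<n. p (n + i) * (of_bool (i = b) * v b) - p i * (of_bool (n + i = b) * v b)) / 4"
    by (simp only: sum_subtractf sum_divide_distrib diff_divide_distrib)
  also have "(\<Sum>b<2*n+1. \<Sum>i<n. p (n + i) * (of_bool (i = b) * v b) - p i * (of_bool (n + i = b) * v b))
      = (\<Sum>i<n. \<Sum>b<2*n+1. p (n + i) * (of_bool (i = b) * v b) - p i * (of_bool (n + i = b) * v b))"
    by (rule sum.swap)
  also have "(\<Sum>b<2*n+1. of_bool (2 * n = b) * v b) = v (2 * n)"
    by (rule sum_of_bool_mult) simp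
  also have "(\<Sum>i<n. \<Sum>b<2*n+1. p (n + i) * (of_bool (i = b) * v b) - p i * (of_bool (n + i = b) * v b))
      = (\<Sum>i<n. p (n + i) * v i - p i * v (n + i))"
    by (intro sum.cong refl) (simp add: sum_subtractf sum_distrib_left[symmetric] del: sum.lessThan_Suc)
  finally show ?thesis by (simp add: contact_form_def)
qed

lemma christoffel_horizontal:
  assumes v: "contact_form n p v = 0" and w: "contact_form n p w = 0"
  shows "(\<Sum>a<2*n+1. \<Sum>b<2*n+1. christoffel n p c a b * v a * w b) = 0"
proof -
  define \<eta> where "\<eta> = (\<lambda>b p. contact_form n p (\<lambda>c. of_bool (c = b)))"
  \<comment> \<open>\<open>B a b\<close> is the derivative of the b-th coefficient of the contact
    form in direction a. It is constant and antisymmetric.\<close>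
  define B :: "nat \<Rightarrow> nat \<Rightarrow> real" where "B = (\<lambda>a b. - (\<Sum>i<n. of_bool (n + i = a) * of_bool (i = b)
    - of_bool (i = a) * of_bool (n + i = b)) / 4)"
  have B: "B b a = - B a b" for a b
    by (simp add: B_def sum_negf[symmetric] algebra_simps)
  have coord: "((\<lambda>t. (p(a := t)) i) has_real_derivative of_bool (i = a)) (at (p a))" for a i
    by (cases "i = a") auto
  have \<eta>: "((\<lambda>t. \<eta> b (p(a := t))) has_real_derivative B a b) (at (p a))" for a b
  proof -
    have "((\<lambda>t. \<eta> b (p(a := t))) has_real_derivative 0 - (\<Sum>i<n. of_bool (n + i = a) * of_bool (i = b)
        - of_bool (i = a) * of_bool (n + i = b)) / 4) (at (p a))"
      unfolding \<eta>_def contact_form_def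
      by (intro DERIV_diff DERIV_const DERIV_cdivide DERIV_sum DERIV_cmult_right coord)
    then show ?thesis by (simp add: B_def)
  qed
  have g: "metric_coeff n a b q = (\<Sum>i<n. of_bool (i = a) * of_bool (i = b)
      + of_bool (n + i = a) * of_bool (n + i = b)) / 4 + \<eta> a q * \<eta> b q" for a b q
    by (simp add: metric_coeff_def contact_metric_def \<eta>_def)
  have dg: "partial_deriv d (metric_coeff n a b) p = B d a * \<eta> b p + \<eta> a p * B d b" for a b d
    unfolding g by (rule partial_deriv_eqI) (rule derivative_eq_intros \<eta> refl | simp)+
  \<comment> \<open>Antisymmetry cancels the terms with \<open>B a b\<close> and
    \<open>B b a\<close> and doubles the others, which absorbs the factor 1/2. Each remaining term
    carries \<eta> in one of the lower indices.\<close>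
  have chr: "christoffel n p c a b
      = (\<Sum>d<2*n+1. metric_inverse n p $$ (c, d) * (B a d * \<eta> b p + B b d * \<eta> a p))" for a b
  proof -
    have "partial_deriv a (metric_coeff n b d) p + partial_deriv b (metric_coeff n a d) p
        - partial_deriv d (metric_coeff n a b) p = 2 * (B a d * \<eta> b p + B b d * \<eta> a p)" for d
      unfolding dg using B[of a b] B[of a d] B[of b d] by (simp add: algebra_simps)
    then show ?thesis
      unfolding christoffel_def
      by (simp only: mult.left_commute[of _ 2] sum_distrib_left[symmetric])
  qed
  have "(\<Sum>a<2*n+1. \<Sum>b<2*n+1. christoffel n p c a b * v a * w b)
      = (\<Sum>a<2*n+1. \<Sum>b<2*n+1. \<Sum>d<2*n+1. metric_inverse n p $$ (c, d) *
          (B a d * v a * (\<eta> b p * w b) + B b d * w b * (\<eta> a p * v a)))"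
    unfolding chr by (simp add: sum_distrib_right sum_distrib_left algebra_simps del: sum.lessThan_Suc)
  also have "\<dots> = (\<Sum>d<2*n+1. \<Sum>a<2*n+1. \<Sum>b<2*n+1. metric_inverse n p $$ (c, d) *
          (B a d * v a * (\<eta> b p * w b) + B b d * w b * (\<eta> a p * v a)))"
    by (subst sum.swap, subst (2) sum.swap) (rule refl)
  also have "\<dots> = (\<Sum>d<2*n+1. metric_inverse n p $$ (c, d) *
      ((\<Sum>a<2*n+1. B a d * v a) * (\<Sum>b<2*n+1. \<eta> b p * w b)
        + (\<Sum>a<2*n+1. \<eta> a p * v a) * (\<Sum>b<2*n+1. B b d * w b)))"
    by (intro sum.cong refl)
      (simp only: sum_distrib_left[symmetric] sum_distrib_right[symmetric] sum.distrib
        mult.commute[of "_ * w _" "_ * v _"])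
  also have "\<dots> = 0"
    using v w unfolding contact_form_sum[of n p v] contact_form_sum[of n p w] \<eta>_def by simp
  finally show ?thesis .
qed

section \<open>Coordinates of the graph, and scalar forms of the shrinker equation\<close>

locale smooth_potential =
  fixes n :: nat and u :: "(nat \<Rightarrow> real) \<Rightarrow> real"
  assumes smooth: "smooth_Rn n u"
begin

abbreviation D1 where "D1 i \<equiv> partial_deriv i u"
abbreviation D2 where "D2 i j \<equiv> partial_deriv i (partial_deriv j u)"
abbreviation D3 where "D3 i j k \<equiv> partial_deriv i (partial_deriv j (partial_deriv k u))"
abbreviation S where "S \<equiv> {..<n} \<rightarrow>\<^sub>E (UNIV :: real set)"

lemma has_derivs:
  assumes "x \<in> S" "i < n"
  shows "((\<lambda>t. u (x(i := t))) has_real_derivative D1 i x) (at (x i))"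
    and "j < n \<Longrightarrow> ((\<lambda>t. D1 j (x(i := t))) has_real_derivative D2 i j x) (at (x i))"
    and "j < n \<Longrightarrow> k < n \<Longrightarrow> ((\<lambda>t. D2 j k (x(i := t))) has_real_derivative D3 i j k x) (at (x i))"
  using smooth_Rn_has_derivative[OF smooth, of "[]"] smooth_Rn_has_derivative[OF smooth, of "[j]"]
    smooth_Rn_has_derivative[OF smooth, of "[j, k]"] assms by simp_all

lemma continuous:
  "continuous_map (powertop_real {..<n}) euclideanreal u"
  "i < n \<Longrightarrow> continuous_map (powertop_real {..<n}) euclideanreal (D1 i)"
  "i < n \<Longrightarrow> j < n \<Longrightarrow> continuous_map (powertop_real {..<n}) euclideanreal (D2 i j)"
  "i < n \<Longrightarrow> j < n \<Longrightarrow> k < n \<Longrightarrow> continuous_map (powertop_real {..<n}) euclideanreal (D3 i j k)"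
  using smooth unfolding smooth_Rn_def
  by (auto dest: spec[of _ "[]"] spec[of _ "[i]"] spec[of _ "[i, j]"] spec[of _ "[i, j, k]"])

lemma D2_commute: "x \<in> S \<Longrightarrow> i < n \<Longrightarrow> j < n \<Longrightarrow> D2 i j x = D2 j i x"
  by (rule partial_deriv_commute[OF smooth])

text \<open>Closed forms of the first and second partial derivatives of V = u - x . Du / 2.\<close>

definition V1 where "V1 i x = (D1 i x - (\<Sum>j<n. x j * D2 i j x)) / 2"
definition V2 where "V2 i j x = - (\<Sum>k<n. x k * D3 i j k x) / 2"

lemma coordinate_derivative:
  "((\<lambda>t. (x(i := t)) j) has_real_derivative of_bool (j = i)) (at (x i))"
  by (cases "j = i") auto

lemma potential_derivative:
  assumes x: "x \<in> S" and i: "i < n"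
  shows "((\<lambda>t. potential n u (x(i := t))) has_real_derivative V1 i x) (at (x i))"
proof -
  have "((\<lambda>t. \<Sum>j<n. (x(i := t)) j * D1 j (x(i := t))) has_real_derivative
      (\<Sum>j<n. of_bool (j = i) * D1 j x + D2 i j x * x j)) (at (x i))"
  proof (rule DERIV_sum)
    show "((\<lambda>t. (x(i := t)) j * D1 j (x(i := t))) has_real_derivative
        of_bool (j = i) * D1 j x + D2 i j x * x j) (at (x i))" if "j \<in> {..<n}" for j
      using DERIV_mult[OF coordinate_derivative[of x i j] has_derivs(2)[OF x i, of j]] that by simp
  qed
  then have "((\<lambda>t. potential n u (x(i := t))) has_real_derivative
      D1 i x - (\<Sum>j<n. of_bool (j = i) * D1 j x + D2 i j x * x j) / 2) (at (x i))"
    unfolding potential_def by (intro DERIV_diff DERIV_cdivide has_derivs(1)[OF x i])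
  also have "D1 i x - (\<Sum>j<n. of_bool (j = i) * D1 j x + D2 i j x * x j) / 2 = V1 i x"
    using i by (simp add: V1_def sum.distrib field_simps)
  finally show ?thesis .
qed

text \<open>The two second-order terms are \<open>D2 i j\<close> and \<open>D2 j i\<close> with
  opposite signs, so by symmetry only third derivatives of u survive. They are what the trace of the
  horizontal equation controls.\<close>

lemma V1_derivative:
  assumes x: "x \<in> S" and i: "i < n" and j: "j < n"
  shows "((\<lambda>t. V1 j (x(i := t))) has_real_derivative V2 i j x) (at (x i))"
proof -
  have "((\<lambda>t. \<Sum>k<n. (x(i := t)) k * D2 j k (x(i := t))) has_real_derivative
      (\<Sum>k<n. of_bool (k = i) * D2 j k x + D3 i j k x * x k)) (at (x i))"
  proof (rule DERIV_sum)
    show "((\<lambda>t. (x(i := t)) k * D2 j k (x(i := t))) has_real_derivative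
        of_bool (k = i) * D2 j k x + D3 i j k x * x k) (at (x i))" if "k \<in> {..<n}" for k
      using DERIV_mult[OF coordinate_derivative[of x i k] has_derivs(3)[OF x i j, of k]] that by simp
  qed
  then have "((\<lambda>t. V1 j (x(i := t))) has_real_derivative
      (D2 i j x - (\<Sum>k<n. of_bool (k = i) * D2 j k x + D3 i j k x * x k)) / 2) (at (x i))"
    unfolding V1_def by (intro DERIV_diff DERIV_cdivide has_derivs(2)[OF x i j])
  also have "(D2 i j x - (\<Sum>k<n. of_bool (k = i) * D2 j k x + D3 i j k x * x k)) / 2 = V2 i j x"
    using i D2_commute[OF x i j] by (simp add: V2_def sum.distrib field_simps)
  finally show ?thesis .
qed

lemma tangent_components:
  assumes x: "x \<in> S" and i: "i < n"
  shows "j < n \<Longrightarrow> tangent n u i x j = of_bool (j = i)"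
    and "j < n \<Longrightarrow> tangent n u i x (n + j) = D2 i j x"
    and "tangent n u i x (2 * n) = V1 i x"
proof -
  show "tangent n u i x j = of_bool (j = i)" if "j < n"
    unfolding tangent_def graph_map_def
    by (rule partial_deriv_eqI) (use that in \<open>auto intro!: derivative_eq_intros\<close>)
  show "tangent n u i x (n + j) = D2 i j x" if "j < n"
    unfolding tangent_def graph_map_def
    by (rule partial_deriv_eqI) (use that has_derivs(2)[OF x i that] in auto)
  show "tangent n u i x (2 * n) = V1 i x"
    unfolding tangent_def graph_map_def
    by (rule partial_deriv_eqI) (use potential_derivative[OF x i] in simp)
qed

lemma tangent_derivatives:
  assumes x: "x \<in> S" and i: "i < n" and j: "j < n"
  shows "k < n \<Longrightarrow> partial_deriv i (\<lambda>y. tangent n u j y k) x = 0"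
    and "k < n \<Longrightarrow> partial_deriv i (\<lambda>y. tangent n u j y (n + k)) x = D3 i j k x"
    and "partial_deriv i (\<lambda>y. tangent n u j y (2 * n)) x = V2 i j x"
  by (rule partial_deriv_eqI,
      simp add: tangent_components[OF upd_mem[OF x i] j] has_derivs(3)[OF x i j] V1_derivative[OF x i j])+

lemma graph_map_components:
  "i < n \<Longrightarrow> graph_map n u x i = x i"
  "i < n \<Longrightarrow> graph_map n u x (n + i) = D1 i x"
  "graph_map n u x (2 * n) = potential n u x"
  by (simp_all add: graph_map_def)

text \<open>The graph is Legendrian, so both tangent vectors lie in the kernel of the contact form,
  where the Christoffel term vanishes.\<close>

lemma cov_deriv_tangent_eq:
  assumes "x \<in> S" "i < n" "j < n"
  shows "cov_deriv_tangent n u i j x a = partial_deriv i (\<lambda>y. tangent n u j y a) x"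
  unfolding cov_deriv_tangent_def
  by (subst christoffel_horizontal) (use assms graph_is_legendrian[OF smooth] in auto)

text \<open>A covector \<phi> that kills the tangent space does not see the projection in
  \<open>normal_part\<close>, so both the second fundamental form and the normal part of the
  position vector can be replaced by the unprojected vectors. The codimension is n + 1: the contact
  form and n horizontal covectors will be inserted.\<close>

lemma contracted_equation:
  fixes c :: "nat \<Rightarrow> real"
  defines "\<phi> \<equiv> \<lambda>v. \<Sum>a<2*n+1. c a * v a"
  assumes eq: "shrinker_equation n u" and x: "x \<in> S"
    and tan: "\<And>i. i < n \<Longrightarrow> \<phi> (tangent n u i x) = 0"
  shows "(\<Sum>i<n. \<Sum>j<n. induced_inverse n u x $$ (i, j) *
      \<phi> (\<lambda>a. partial_deriv i (\<lambda>y. tangent n u j y a) x))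
      - legendrian_angle n u x * \<phi> (reeb n) = - (1/2) * \<phi> (graph_map n u x)"
proof -
  have dd: "\<phi> (\<lambda>a. \<Sum>i<n. \<Sum>j<n. C i j * T i j a) = (\<Sum>i<n. \<Sum>j<n. C i j * \<phi> (T i j))"
    for C :: "nat \<Rightarrow> nat \<Rightarrow> real" and T
  proof -
    have "\<phi> (\<lambda>a. \<Sum>i<n. \<Sum>j<n. C i j * T i j a)
        = (\<Sum>a<2*n+1. \<Sum>i<n. \<Sum>j<n. C i j * (c a * T i j a))"
      unfolding \<phi>_def by (simp add: sum_distrib_left mult_ac del: sum.lessThan_Suc)
    also have "\<dots> = (\<Sum>i<n. \<Sum>j<n. \<Sum>a<2*n+1. C i j * (c a * T i j a))"
      by (rule trans[OF sum.swap]) (intro sum.cong refl sum.swap)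
    finally show ?thesis unfolding \<phi>_def by (simp add: sum_distrib_left del: sum.lessThan_Suc)
  qed
  have normal: "\<phi> (normal_part n u x v) = \<phi> v" for v
  proof -
    have "\<phi> (normal_part n u x v) = \<phi> v - \<phi> (\<lambda>a. \<Sum>i<n. \<Sum>j<n. (induced_inverse n u x $$ (i, j) *
              contact_metric n (graph_map n u x) v (tangent n u i x)) * tangent n u j x a)"
      unfolding \<phi>_def normal_part_def by (simp add: sum_subtractf algebra_simps del: sum.lessThan_Suc)
    also have "\<dots> = \<phi> v" unfolding dd using tan by simp
    finally show ?thesis .
  qed
  have "\<phi> (\<lambda>a. mean_curvature n u x a - legendrian_angle n u x * reeb n a)
      = \<phi> (\<lambda>a. - (1/2) * normal_part n u x (graph_map n u x) a)"
    unfolding \<phi>_def using eq x by (intro sum.cong refl) (auto simp: shrinker_equation_def)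
  moreover have "\<phi> (\<lambda>a. mean_curvature n u x a - legendrian_angle n u x * reeb n a)
      = \<phi> (mean_curvature n u x) - legendrian_angle n u x * \<phi> (reeb n)"
    unfolding \<phi>_def by (simp add: sum_subtractf sum_distrib_left algebra_simps del: sum.lessThan_Suc)
  moreover have "\<phi> (\<lambda>a. - (1/2) * normal_part n u x (graph_map n u x) a)
      = - (1/2) * \<phi> (normal_part n u x (graph_map n u x))"
    unfolding \<phi>_def by (simp add: sum_distrib_left mult_ac sum_negf sum_divide_distrib del: sum.lessThan_Suc)
  moreover have "\<phi> (mean_curvature n u x) = (\<Sum>i<n. \<Sum>j<n. induced_inverse n u x $$ (i, j) *
      \<phi> (\<lambda>a. partial_deriv i (\<lambda>y. tangent n u j y a) x))"
  proof -
    have "\<phi> (mean_curvature n u x) = (\<Sum>i<n. \<Sum>j<n. induced_inverse n u x $$ (i, j) *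
      \<phi> (second_fundamental_form n u i j x))"
      using dd unfolding mean_curvature_def[abs_def] .
    moreover have "\<phi> (second_fundamental_form n u i j x) = \<phi> (\<lambda>a. partial_deriv i (\<lambda>y. tangent n u j y a) x)"
      if "i < n" "j < n" for i j
      unfolding second_fundamental_form_def normal using cov_deriv_tangent_eq[OF x that]
      by (simp add: fun_eq_iff \<phi>_def)
    ultimately show ?thesis by simp
  qed
  ultimately show ?thesis by (simp add: normal)
qed

text \<open>Contraction with the contact form \<eta>. The second derivatives of the parametrization
  are killed, since the z-entry \<open>V2\<close> cancels the x-weighted third derivatives; \<eta>
  is 1 on the Reeb field and V / 2 on the position vector, which leaves -\<theta> = -V / 4.\<close>

lemma potential_eq_angle:
  assumes eq: "shrinker_equation n u" and x: "x \<in> S"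
  shows "potential n u x = 4 * legendrian_angle n u x"
proof -
  let ?c = "\<lambda>b. contact_form n (graph_map n u x) (\<lambda>c. of_bool (c = b))"
  have "contact_form n (graph_map n u x) (\<lambda>a. partial_deriv i (\<lambda>y. tangent n u j y a) x) = 0"
    if "i < n" "j < n" for i j
    by (simp add: contact_form_def tangent_derivatives[OF x that] graph_map_components V2_def
      sum_negf)
  moreover have "contact_form n (graph_map n u x) (reeb n) = 1"
    by (simp add: contact_form_def reeb_def)
  moreover have "contact_form n (graph_map n u x) (graph_map n u x) = potential n u x / 2"
    by (simp add: contact_form_def graph_map_components mult.commute[of "x _"])
  ultimately show ?thesis
    using contracted_equation[OF eq x, of ?c] graph_is_legendrian[OF smooth x]
    unfolding contact_form_sum[of n "graph_map n u x", symmetric] by simp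
qed

lemma horizontal_equation:
  assumes eq: "shrinker_equation n u" and x: "x \<in> S" and k: "k < n"
  shows "(\<Sum>i<n. \<Sum>j<n. induced_inverse n u x $$ (i, j) * D3 i j k x) = - V1 k x"
proof -
  \<comment> \<open>The covector dy_k - sum_a u_ak dx_a. It vanishes on tangent vectors and on the
    Reeb field, and on the position vector it equals u_k - sum_a x_a u_ak, which is twice the k-th
    derivative of V.\<close>
  let ?c = "\<lambda>a. of_bool (a = n + k) - (if a < n then D2 a k x else 0)"
  have c: "(\<Sum>a<2*n+1. ?c a * v a) = v (n + k) - (\<Sum>a<n. D2 a k x * v a)" for v
  proof -
    have "(\<Sum>a<2*n+1. ?c a * v a) = (\<Sum>a<2*n+1. of_bool (a = n + k) * v a)
        - (\<Sum>a<2*n+1. if a \<in> {..<n} then D2 a k x * v a else 0)"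
      unfolding sum_subtractf[symmetric] by (intro sum.cong refl) (auto simp: algebra_simps)
    also have "(\<Sum>a<2*n+1. of_bool (a = n + k) * v a) = v (n + k)"
      using k by (intro sum_of_bool_mult) simp
    also have "(\<Sum>a<2*n+1. if a \<in> {..<n} then D2 a k x * v a else 0) = (\<Sum>a<n. D2 a k x * v a)"
      by (subst sum.inter_restrict[symmetric]) (auto intro!: sum.cong)
    finally show ?thesis .
  qed
  have "(\<Sum>a<2*n+1. ?c a * tangent n u i x a) = 0" if "i < n" for i
    unfolding c using that k by (simp add: tangent_components[OF x that])
  from contracted_equation[OF eq x, of ?c, OF this]
  have "(\<Sum>i<n. \<Sum>j<n. induced_inverse n u x $$ (i, j) * D3 i j k x)
      = - (1/2) * (D1 k x - (\<Sum>a<n. D2 a k x * x a))"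
    unfolding c using k
    by (simp add: tangent_derivatives[OF x] reeb_def graph_map_components)
  also have "(\<Sum>a<n. D2 a k x * x a) = (\<Sum>a<n. x a * D2 k a x)"
    using k by (intro sum.cong refl) (simp add: D2_commute[OF x _ k])
  finally show ?thesis by (simp add: V1_def)
qed

text \<open>The horizontal equation, multiplied by -x_k / 2 and summed over k: the third derivatives
  of u assemble into the Hessian of V.\<close>

lemma potential_equation:
  assumes eq: "shrinker_equation n u" and x: "x \<in> S"
  shows "(\<Sum>i<n. \<Sum>j<n. induced_inverse n u x $$ (i, j) * V2 i j x) = (\<Sum>k<n. x k * V1 k x) / 2"
proof -
  have "(\<Sum>i<n. \<Sum>j<n. induced_inverse n u x $$ (i, j) * V2 i j x)
      = (\<Sum>i<n. \<Sum>j<n. \<Sum>k<n. - (x k * (induced_inverse n u x $$ (i, j) * D3 i j k x)) / 2)"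
    unfolding V2_def
    by (simp add: sum_distrib_left sum_divide_distrib sum_negf mult_ac)
  also have "\<dots> = (\<Sum>k<n. \<Sum>i<n. \<Sum>j<n. - (x k * (induced_inverse n u x $$ (i, j) * D3 i j k x)) / 2)"
    by (subst (2) sum.swap, subst sum.swap) simp
  also have "\<dots> = (\<Sum>k<n. - (x k * (\<Sum>i<n. \<Sum>j<n. induced_inverse n u x $$ (i, j) * D3 i j k x)) / 2)"
    by (simp add: sum_distrib_left sum_divide_distrib sum_negf mult_ac)
  finally show ?thesis
    by (simp add: horizontal_equation[OF eq x] sum_divide_distrib)
qed

text \<open>The multiplicities of the real eigenvalues add up to at most the degree n of the
  characteristic polynomial. The crude bound \<pi> for arctan is enough, as only boundedness of V
  matters.\<close>

lemma legendrian_angle_bound: "\<bar>legendrian_angle n u x\<bar> \<le> real n * pi"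
proof -
  let ?p = "char_poly (hessian n u x)"
  have H: "hessian n u x \<in> carrier_mat n n" by (simp add: hessian_def)
  have "monic ?p" and deg: "degree ?p = n" using degree_monic_char_poly[OF H] by simp_all
  then have "?p \<noteq> 0" by auto
  have "\<bar>legendrian_angle n u x\<bar> \<le> (\<Sum>l | eigenvalue (hessian n u x) l. \<bar>real (order l ?p) * arctan l\<bar>)"
    unfolding legendrian_angle_def by simp
  also have "\<dots> \<le> (\<Sum>l | eigenvalue (hessian n u x) l. real (order l ?p) * pi)"
  proof (rule sum_mono)
    fix l
    have "\<bar>arctan l\<bar> \<le> pi"
      using arctan_bounded[of l] pi_gt_zero by linarith
    then show "\<bar>real (order l ?p) * arctan l\<bar> \<le> real (order l ?p) * pi"
      by (simp add: abs_mult mult_left_mono)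
  qed
  also have "\<dots> = real (\<Sum>l | poly ?p l = 0. order l ?p) * pi"
    by (simp add: eigenvalue_root_char_poly[OF H] sum_distrib_right)
  also have "\<dots> \<le> real n * pi"
    using sum_order_le_degree[OF \<open>?p \<noteq> 0\<close>] deg by (intro mult_right_mono) (simp_all del: of_nat_sum)
  finally show ?thesis .
qed

end

subsection \<open>A Liouville theorem\<close>

text \<open>A box rather than a ball, because compactness of products applies to it
  directly.\<close>

lemma continuous_attains_max_on_box:
  fixes f :: "(nat \<Rightarrow> real) \<Rightarrow> real"
  assumes "continuous_map (powertop_real {..<n}) euclideanreal f" and R: "R \<ge> 0"
  shows "\<exists>z \<in> {..<n} \<rightarrow>\<^sub>E {-R..R}. \<forall>x \<in> {..<n} \<rightarrow>\<^sub>E {-R..R}. f x \<le> f z"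
proof -
  let ?B = "{..<n} \<rightarrow>\<^sub>E {-R..R}"
  have "compactin (powertop_real {..<n}) ?B" by (simp add: compactin_PiE)
  from image_compactin[OF this assms(1)] have "compact (f ` ?B)" by simp
  moreover have "f ` ?B \<noteq> {}" using R by (auto simp: PiE_eq_empty_iff)
  ultimately show ?thesis using compact_attains_sup[of "f ` ?B"] by auto
qed

lemma continuous_square_norm:
  "continuous_map (powertop_real {..<n}) euclideanreal (\<lambda>x. \<Sum>i<(n::nat). (x i)\<^sup>2)"
  by (intro continuous_map_sum continuous_map_real_pow continuous_map_product_projection) auto

lemma second_derivative_test:
  fixes f f' :: "real \<Rightarrow> real"
  assumes f: "\<And>t. (f has_real_derivative f' t) (at t)"
    and f': "(f' has_real_derivative D) (at 0)"
    and d: "d > 0" and max: "\<And>t. \<bar>t\<bar> < d \<Longrightarrow> f t \<le> f 0"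
  shows "f' 0 = 0" "D \<le> 0"
proof -
  show zero: "f' 0 = 0"
    using DERIV_local_max[OF f d] max by auto
  show "D \<le> 0"
  proof (rule ccontr)
    assume "\<not> D \<le> 0"
    then have "D > 0" by simp
    from DERIV_pos_inc_right[OF f' this] obtain e where e: "e > 0"
      "\<And>h. h > 0 \<Longrightarrow> h < e \<Longrightarrow> f' 0 < f' (0 + h)" by blast
    define h where "h = min d e / 2"
    have h: "0 < h" "h < d" "h < e" using d e by (auto simp: h_def)
    from MVT2[OF h(1), of f f'] f obtain c where c: "0 < c" "c < h" "f h - f 0 = (h - 0) * f' c"
      by blast
    have "f' c > 0" using e(2)[of c] c h zero by simp
    then have "h * f' c > 0" using h by simp
    then have "f h > f 0" using c by simp
    then show False using max[of h] h by auto
  qed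
qed

text \<open>If w y exceeded w at the origin, then w minus a small multiple of the barrier would have
  an interior maximum away from the origin, where the equation contradicts the strictness of the
  barrier. Positive semidefiniteness of Q is stated in the dual form \<open>elliptic\<close>, ready
  to be applied to a negative semidefinite Hessian; in \<open>lower\<close> the constant may depend
  on the outer radius.\<close>

lemma liouville_upper:
  fixes n :: nat and w :: "(nat \<Rightarrow> real) \<Rightarrow> real" and Q :: "(nat \<Rightarrow> real) \<Rightarrow> nat \<Rightarrow> nat \<Rightarrow> real"
  defines "S \<equiv> {..<n} \<rightarrow>\<^sub>E (UNIV :: real set)"
  assumes w: "continuous_map (powertop_real {..<n}) euclideanreal w"
    and w1: "\<And>i. i < n \<Longrightarrow> continuous_map (powertop_real {..<n}) euclideanreal (w1 i)"
    and w2: "\<And>i j. i < n \<Longrightarrow> j < n \<Longrightarrow> continuous_map (powertop_real {..<n}) euclideanreal (w2 i j)"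
    and dw: "\<And>i x. i < n \<Longrightarrow> x \<in> S \<Longrightarrow>
      ((\<lambda>t. w (x(i := t))) has_real_derivative w1 i x) (at (x i))"
    and dw1: "\<And>i j x. i < n \<Longrightarrow> j < n \<Longrightarrow> x \<in> S \<Longrightarrow>
      ((\<lambda>t. w1 j (x(i := t))) has_real_derivative w2 i j x) (at (x i))"
    and bound: "\<And>x. x \<in> S \<Longrightarrow> \<bar>w x\<bar> \<le> W"
    and elliptic: "\<And>x B. x \<in> S \<Longrightarrow> (\<And>v. (\<Sum>k<n. \<Sum>l<n. v k * v l * B k l) \<le> 0) \<Longrightarrow>
      (\<Sum>k<n. \<Sum>l<n. Q x k l * B k l) \<le> 0"
    and trace: "\<And>x. x \<in> S \<Longrightarrow> (\<Sum>k<n. Q x k k) \<le> T" and T: "T > 0"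
    and lower: "\<And>d R. d > 0 \<Longrightarrow> \<exists>q>0. \<forall>x\<in>S. d \<le> (\<Sum>i<n. (x i)\<^sup>2) \<longrightarrow> (\<Sum>i<n. (x i)\<^sup>2) \<le> R \<longrightarrow>
      q \<le> (\<Sum>k<n. \<Sum>l<n. Q x k l * (x k * x l))"
    and pde: "\<And>x. x \<in> S \<Longrightarrow> (\<Sum>k<n. \<Sum>l<n. Q x k l * w2 k l x) = (\<Sum>k<n. x k * w1 k x) / 2"
    and y: "y \<in> S"
  shows "w y \<le> w (\<lambda>i\<in>{..<n}. 0)"
proof (rule ccontr)
  let ?o = "\<lambda>i\<in>{..<n}. 0 :: real"
  let ?s = "\<lambda>x :: nat \<Rightarrow> real. \<Sum>i<n. (x i)\<^sup>2"
  assume "\<not> ?thesis"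
  then have less: "w ?o < w y" by simp
  \<comment> \<open>A level strictly between the two values: w stays below m near the origin, so a
    point where the penalized function exceeds m is at a definite distance from it.\<close>
  define m where "m = (w ?o + w y) / 2"
  have m: "w ?o < m" "m < w y" using less by (auto simp: m_def)
  have s_nonneg: "0 \<le> ?s x" for x :: "nat \<Rightarrow> real" by (simp add: sum_nonneg)
  have coord_le: "(x i)\<^sup>2 \<le> ?s x" if "i < n" for x :: "nat \<Rightarrow> real" and i
    using that by (intro member_le_sum) auto
  obtain d where d: "d > 0" "\<And>x. x \<in> S \<Longrightarrow> ?s x < d \<Longrightarrow> w x < m"
  proof -
    let ?A = "{x \<in> topspace (powertop_real {..<n}). w x \<in> {..<m}}"
    have "openin (powertop_real {..<n}) ?A"
      using w by (rule openin_continuous_map_preimage) auto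
    moreover have "?o \<in> ?A" using m by auto
    ultimately have "\<exists>U. finite {i \<in> {..<n}. U i \<noteq> topspace euclideanreal} \<and>
        (\<forall>i\<in>{..<n}. openin euclideanreal (U i)) \<and> ?o \<in> Pi\<^sub>E {..<n} U \<and> Pi\<^sub>E {..<n} U \<subseteq> ?A"
      unfolding openin_product_topology_alt by (rule bspec)
    then obtain U where U: "\<forall>i\<in>{..<n}. openin euclideanreal (U i)"
      "?o \<in> Pi\<^sub>E {..<n} U" "Pi\<^sub>E {..<n} U \<subseteq> ?A"
      by (elim exE conjE) (rule that)
    have "\<exists>e>0. ball 0 e \<subseteq> U i" if "i < n" for i
    proof -
      have "open (U i)" "0 \<in> U i" using U(1,2) that by (auto simp: PiE_def Pi_def)
      then show ?thesis by (auto simp: open_contains_ball)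
    qed
    then obtain e where e: "\<And>i. i < n \<Longrightarrow> e i > 0" "\<And>i. i < n \<Longrightarrow> ball 0 (e i) \<subseteq> U i"
      by metis
    \<comment> \<open>The inserted 1 keeps the minimum over a nonempty set when n = 0.\<close>
    define d where "d = Min (insert 1 ((\<lambda>i. (e i)\<^sup>2) ` {..<n}))"
    have "(e i)\<^sup>2 > 0" if "i < n" for i using e(1)[OF that] by simp
    then have "d > 0" unfolding d_def by (subst Min_gr_iff) auto
    moreover have "w x < m" if x: "x \<in> S" and less: "?s x < d" for x
    proof -
      have "x i \<in> U i" if i: "i < n" for i
      proof -
        have "d \<le> (e i)\<^sup>2" unfolding d_def using i by (intro Min_le) auto
        then have "\<bar>x i\<bar>\<^sup>2 < (e i)\<^sup>2" using coord_le[OF i, of x] less by simp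
        then have "\<bar>x i\<bar> < e i"
          using e(1)[OF i] by (intro power_less_imp_less_base[of "\<bar>x i\<bar>" 2]) auto
        then show ?thesis using e(2)[OF i] by (auto simp: dist_norm)
      qed
      then have "x \<in> Pi\<^sub>E {..<n} U" using x by (auto simp: S_def PiE_def Pi_def)
      then show ?thesis using U(3) by auto
    qed
    ultimately show ?thesis using that by blast
  qed
  obtain q where q: "q > 0" "\<And>x. x \<in> S \<Longrightarrow> d \<le> ?s x \<Longrightarrow> ?s x \<le> 2 * T \<Longrightarrow>
      q \<le> (\<Sum>k<n. \<Sum>l<n. Q x k l * (x k * x l))"
    using lower[OF d(1), of "2 * T"] by blast
  \<comment> \<open>The barrier \<open>\<psi> (|x|\<^sup>2)\<close> is a strict supersolution outside the origin: for \<open>|x|\<^sup>2 > 2T\<close> by the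
    drift term, for smaller \<open>|x|\<close> by the concavity of \<open>\<psi>\<close>, which ellipticity turns into a
    dominating negative term once \<open>\<alpha>\<close> is large.\<close>
  define \<alpha> where "\<alpha> = T / q + 1"
  have \<alpha>: "\<alpha> > 0" "\<alpha> * q > T" using q T by (auto simp: \<alpha>_def field_simps)
  \<comment> \<open>Chosen so that \<open>K * exp (- \<alpha> * s)\<close> is at least 1 for s up to
    2T; there \<psi>' is at most twice this exponential, and 4 \<alpha> q times it exceeds 2 T
    \<psi>'.\<close>
  define K where "K = exp (2 * \<alpha> * T)"
  have K: "K > 0" by (simp add: K_def)
  define \<psi> where "\<psi> = (\<lambda>s. s + K * (1 - exp (- \<alpha> * s)) / \<alpha>)"
  define \<psi>1 where "\<psi>1 = (\<lambda>s. 1 + K * exp (- \<alpha> * s))"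
  define \<psi>2 where "\<psi>2 = (\<lambda>s. - \<alpha> * K * exp (- \<alpha> * s))"
  have d\<psi>: "(\<psi> has_real_derivative \<psi>1 s) (at s)" for s
    unfolding \<psi>_def \<psi>1_def using \<alpha> by (auto intro!: derivative_eq_intros)
  have d\<psi>1: "(\<psi>1 has_real_derivative \<psi>2 s) (at s)" for s
    unfolding \<psi>1_def \<psi>2_def by (auto intro!: derivative_eq_intros)
  have \<psi>_ge: "s \<le> \<psi> s" if "s \<ge> 0" for s
    using that \<alpha> K by (auto simp: \<psi>_def)
  \<comment> \<open>At y the penalty costs at most half of the gap between w y and m; the 1 keeps
    the denominator positive.\<close>
  define \<epsilon> where "\<epsilon> = (w y - m) / 2 / (\<psi> (?s y) + 1)"
  have \<psi>y: "\<psi> (?s y) \<ge> 0" using \<psi>_ge[OF s_nonneg, of y] s_nonneg[of y] by linarith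
  have \<epsilon>: "\<epsilon> > 0" using m \<psi>y by (simp add: \<epsilon>_def)
  have \<epsilon>y: "w y - \<epsilon> * \<psi> (?s y) > m"
  proof -
    have "\<epsilon> * \<psi> (?s y) \<le> \<epsilon> * (\<psi> (?s y) + 1)" using \<epsilon> by simp
    also have "\<dots> = (w y - m) / 2"
      using \<psi>y unfolding \<epsilon>_def by (intro nonzero_eq_divide_eq[THEN iffD1, OF _ refl]) linarith
    finally have le: "\<epsilon> * \<psi> (?s y) \<le> (w y - m) / 2" .
    have "b < a - c" if "c \<le> (a - b) / 2" "b < a" for a b c :: real
      using that by (simp add: field_simps)
    from this[OF le m(2)] show ?thesis .
  qed
  \<comment> \<open>Once |x|^2 reaches R, the penalty brings w, which is at most W, below m. The
    same R bounds |y|^2, and R \<ge> 1 gives R \<le> R^2, so a bound by R on |x|^2 also bounds each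
    coordinate by R.\<close>
  define R where "R = max (?s y) ((W - m) / \<epsilon>) + 1"
  have R: "R \<ge> 1" "?s y < R" "(W - m) / \<epsilon> < R" using s_nonneg[of y] by (auto simp: R_def)
  have R2: "R \<le> R\<^sup>2" using R by (simp add: power2_eq_square)
  define \<Phi> where "\<Phi> = (\<lambda>x. w x - \<epsilon> * \<psi> (?s x))"
  have \<Phi>_cont: "continuous_map (powertop_real {..<n}) euclideanreal \<Phi>"
  proof -
    have "continuous_on UNIV \<psi>" using d\<psi> by (metis DERIV_isCont continuous_at_imp_continuous_on)
    then have "continuous_map euclideanreal euclideanreal \<psi>" by simp
    from continuous_map_compose[OF continuous_square_norm this]
    show ?thesis unfolding \<Phi>_def o_def
      by (intro continuous_map_diff continuous_map_real_mult w) auto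
  qed
  from continuous_attains_max_on_box[OF \<Phi>_cont, of R] R obtain z where
    z: "z \<in> {..<n} \<rightarrow>\<^sub>E {-R..R}" "\<And>x. x \<in> {..<n} \<rightarrow>\<^sub>E {-R..R} \<Longrightarrow> \<Phi> x \<le> \<Phi> z" by auto
  have zS: "z \<in> S" using z by (auto simp: S_def)
  have "y \<in> {..<n} \<rightarrow>\<^sub>E {-R..R}"
  proof -
    have "\<bar>y i\<bar> \<le> R" if i: "i < n" for i
    proof -
      have "\<bar>y i\<bar>\<^sup>2 \<le> R\<^sup>2" using coord_le[OF i, of y] R R2 by simp
      then show ?thesis using R by (intro power2_le_imp_le[of "\<bar>y i\<bar>" R]) auto
    qed
    then show ?thesis using y unfolding S_def PiE_iff abs_le_iff by (auto simp: minus_le_iff)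
  qed
  from z(2)[OF this] have \<Phi>z: "\<Phi> z > m" using \<epsilon>y by (simp add: \<Phi>_def)
  have sz: "?s z < R"
  proof (rule ccontr)
    assume "\<not> ?s z < R"
    then have "R \<le> \<psi> (?s z)" using \<psi>_ge[OF s_nonneg, of z] by linarith
    then have "\<epsilon> * R \<le> \<epsilon> * \<psi> (?s z)" using \<epsilon> by simp
    moreover have "W - m < \<epsilon> * R" using R(3) \<epsilon> by (simp add: field_simps)
    moreover have "w z \<le> W" using bound[OF zS] by simp
    ultimately show False using \<Phi>z by (simp add: \<Phi>_def)
  qed
  have dz: "d \<le> ?s z"
  proof (rule ccontr)
    assume "\<not> d \<le> ?s z"
    then have "w z < m" using d(2)[OF zS] by simp
    moreover have "\<epsilon> * \<psi> (?s z) \<ge> 0" using \<epsilon> \<psi>_ge[OF s_nonneg, of z] s_nonneg[of z] by simp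
    ultimately show False using \<Phi>z by (simp add: \<Phi>_def)
  qed
  have zR: "\<bar>z i\<bar> < R" if i: "i < n" for i
  proof -
    have "\<bar>z i\<bar>\<^sup>2 < R\<^sup>2" using coord_le[OF i, of z] sz R2 by simp
    then show ?thesis using R by (intro power_less_imp_less_base[of "\<bar>z i\<bar>" 2 R]) auto
  qed
  define L where "L = (\<lambda>v t. \<lambda>i\<in>{..<n}. z i + t * v i)"
  have L0: "L v 0 = z" for v using zS by (auto simp: L_def S_def fun_eq_iff PiE_def extensional_def)
  have "\<exists>r>0. \<forall>t. \<bar>t\<bar> < r \<longrightarrow> L v t \<in> {..<n} \<rightarrow>\<^sub>E {-R..R}" for v
  proof -
    have "\<forall>\<^sub>F t in nhds 0. \<forall>i\<in>{..<n}. z i + t * v i \<in> {-R<..<R}"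
    proof (rule eventually_ball_finite, simp, rule ballI)
      fix i assume "i \<in> {..<n}"
      then have "z i + 0 * v i \<in> {-R<..<R}" using zR[of i] by (auto simp: abs_less_iff)
      moreover have "((\<lambda>t. z i + t * v i) \<longlongrightarrow> z i + 0 * v i) (nhds 0)"
        by (intro tendsto_intros filterlim_ident)
      ultimately show "\<forall>\<^sub>F t in nhds 0. z i + t * v i \<in> {-R<..<R}"
        by (intro topological_tendstoD[OF _ open_greaterThanLessThan])
    qed
    then obtain r where "r > 0" "\<forall>t. dist t 0 < r \<longrightarrow> (\<forall>i\<in>{..<n}. z i + t * v i \<in> {-R<..<R})"
      unfolding eventually_nhds_metric by blast
    then show ?thesis by (intro exI[of _ r]) (auto simp: L_def less_imp_le)
  qed
  then obtain r where r: "\<And>v. r v > 0" "\<And>v t. \<bar>t\<bar> < r v \<Longrightarrow> L v t \<in> {..<n} \<rightarrow>\<^sub>E {-R..R}"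
    by metis
  define f1 where "f1 = (\<lambda>v t. (\<Sum>k<n. v k * w1 k (L v t))
    - \<epsilon> * (\<psi>1 (?s (L v t)) * (\<Sum>k<n. 2 * v k * L v t k)))"
  have dL: "((\<lambda>t. L v t k) has_real_derivative v k) (at t)" if "k < n" for v k t
    using that by (auto simp: L_def intro!: derivative_eq_intros)
  have ds: "((\<lambda>t. ?s (L v t)) has_real_derivative (\<Sum>k<n. 2 * v k * L v t k)) (at t)" for v t
    by (rule DERIV_sum) (auto intro!: derivative_eq_intros dL)
  have df: "((\<lambda>t. \<Phi> (L v t)) has_real_derivative f1 v t) (at t)" for v t
  proof -
    have "((\<lambda>t. w (L v t)) has_real_derivative (\<Sum>k<n. v k * w1 k (L v t))) (at t)"
      unfolding L_def by (rule DERIV_along_line, fact w1, fact dw[unfolded S_def])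
    moreover have "((\<lambda>t. \<epsilon> * \<psi> (?s (L v t))) has_real_derivative
        \<epsilon> * (\<psi>1 (?s (L v t)) * (\<Sum>k<n. 2 * v k * L v t k))) (at t)"
      by (intro DERIV_cmult DERIV_chain2[OF d\<psi> ds])
    ultimately show ?thesis unfolding \<Phi>_def f1_def by (rule DERIV_diff)
  qed
  \<comment> \<open>The Hessian at z of the penalized function. The index order of \<open>w2\<close>
    is the one that differentiation along lines produces; it is transposed later to match the
    equation, so symmetry of \<open>w2\<close> is never invoked.\<close>
  define H where "H = (\<lambda>k l. w2 l k z - \<epsilon> * (4 * \<psi>2 (?s z) * (z k * z l) + 2 * \<psi>1 (?s z) * of_bool (k = l)))"
  have df1: "(f1 v has_real_derivative (\<Sum>k<n. \<Sum>l<n. v k * v l * H k l)) (at 0)" for v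
  proof -
    have 1: "((\<lambda>t. \<Sum>k<n. v k * w1 k (L v t)) has_real_derivative
        (\<Sum>k<n. v k * (\<Sum>l<n. v l * w2 l k (L v 0)))) (at 0)"
    proof (intro DERIV_sum DERIV_cmult)
      fix k assume "k \<in> {..<n}"
      then have k: "k < n" by simp
      show "((\<lambda>t. w1 k (L v t)) has_real_derivative (\<Sum>l<n. v l * w2 l k (L v 0))) (at 0)"
        unfolding L_def
        by (rule DERIV_along_line, rule w2[OF _ k], assumption)
          (rule dw1[OF _ k, unfolded S_def], assumption+)
    qed
    have 2: "((\<lambda>t. \<Sum>k<n. 2 * v k * L v t k) has_real_derivative (\<Sum>k<n. 2 * v k * v k)) (at 0)"
      by (intro DERIV_sum DERIV_cmult dL) auto
    have 3: "((\<lambda>t. \<psi>1 (?s (L v t))) has_real_derivative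
        \<psi>2 (?s (L v 0)) * (\<Sum>k<n. 2 * v k * L v 0 k)) (at 0)"
      by (rule DERIV_chain2[OF d\<psi>1 ds])
    let ?z = "\<Sum>k<n. 2 * v k * z k"
    have "(f1 v has_real_derivative (\<Sum>k<n. v k * (\<Sum>l<n. v l * w2 l k z))
        - \<epsilon> * (\<psi>2 (?s z) * ?z * ?z + (\<Sum>k<n. 2 * v k * v k) * \<psi>1 (?s z))) (at 0)"
      unfolding f1_def
      using DERIV_diff[OF 1 DERIV_cmult[OF DERIV_mult[OF 3 2]], of \<epsilon>] by (simp add: L0)
    moreover have "(\<Sum>k<n. \<Sum>l<n. v k * v l * H k l) = (\<Sum>k<n. v k * (\<Sum>l<n. v l * w2 l k z))
        - \<epsilon> * (\<psi>2 (?s z) * ?z * ?z + (\<Sum>k<n. 2 * v k * v k) * \<psi>1 (?s z))"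
    proof -
      have "(\<Sum>k<n. \<Sum>l<n. v k * v l * H k l) = (\<Sum>k<n. \<Sum>l<n. v k * (v l * w2 l k z)
          - \<epsilon> * (\<psi>2 (?s z) * ((2 * v k * z k) * (2 * v l * z l))
          + \<psi>1 (?s z) * (of_bool (k = l) * (2 * v k * v l))))"
        by (intro sum.cong refl) (simp add: H_def algebra_simps)
      also have "\<dots> = (\<Sum>k<n. v k * (\<Sum>l<n. v l * w2 l k z))
          - \<epsilon> * (\<psi>2 (?s z) * (?z * ?z) + \<psi>1 (?s z) * (\<Sum>k<n. \<Sum>l<n. of_bool (k = l) * (2 * v k * v l)))"
        by (simp only: sum_subtractf sum.distrib sum_distrib_left[symmetric] sum_distrib_right[symmetric])
      also have "(\<Sum>k<n. \<Sum>l<n. of_bool (k = l) * (2 * v k * v l)) = (\<Sum>k<n. 2 * v k * v k)"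
        by (intro sum.cong refl) simp
      finally show ?thesis by (simp add: mult_ac)
    qed
    ultimately show ?thesis by simp
  qed
  have max: "\<Phi> (L v t) \<le> \<Phi> (L v 0)" if "\<bar>t\<bar> < r v" for v t
    unfolding L0 by (rule z(2)[OF r(2)[OF that]])
  have crit: "f1 v 0 = 0" and neg: "(\<Sum>k<n. \<Sum>l<n. v k * v l * H k l) \<le> 0" for v
    using second_derivative_test[OF df df1 r(1) max] by simp_all
  let ?q = "\<Sum>k<n. \<Sum>l<n. Q z k l * (z k * z l)"
  let ?t = "\<Sum>k<n. Q z k k"
  have "(\<Sum>k<n. \<Sum>l<n. Q z k l * H l k) \<le> 0"
  proof (rule elliptic[OF zS, of "\<lambda>k l. H l k"])
    show "(\<Sum>k<n. \<Sum>l<n. v k * v l * H l k) \<le> 0" for v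
      using neg[of v] by (subst sum.swap) (simp add: mult.commute)
  qed
  moreover have "(\<Sum>k<n. \<Sum>l<n. Q z k l * H l k)
      = (\<Sum>k<n. \<Sum>l<n. Q z k l * w2 k l z) - \<epsilon> * (4 * \<psi>2 (?s z) * ?q + 2 * \<psi>1 (?s z) * ?t)"
  proof -
    have "(\<Sum>k<n. \<Sum>l<n. Q z k l * H l k) = (\<Sum>k<n. \<Sum>l<n. Q z k l * w2 k l z
        - \<epsilon> * (4 * \<psi>2 (?s z) * (Q z k l * (z k * z l)) + 2 * \<psi>1 (?s z) * (of_bool (k = l) * Q z k l)))"
      by (intro sum.cong refl) (auto simp: H_def algebra_simps)
    also have "\<dots> = (\<Sum>k<n. \<Sum>l<n. Q z k l * w2 k l z)
        - \<epsilon> * (4 * \<psi>2 (?s z) * ?q + 2 * \<psi>1 (?s z) * (\<Sum>k<n. \<Sum>l<n. of_bool (k = l) * Q z k l))"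
      by (simp only: sum_subtractf sum.distrib sum_distrib_left[symmetric])
    finally show ?thesis by simp
  qed
  \<comment> \<open>Criticality in the radial direction v = z evaluates the drift term
    exactly.\<close>
  moreover have "(\<Sum>k<n. z k * w1 k z) = 2 * \<epsilon> * \<psi>1 (?s z) * ?s z"
  proof -
    have "(\<Sum>k<n. 2 * z k * z k) = 2 * ?s z"
      by (simp add: power2_eq_square sum_distrib_left mult_ac)
    with crit[of z] show ?thesis by (simp add: f1_def L0)
  qed
  ultimately have "\<epsilon> * (\<psi>1 (?s z) * ?s z - 4 * \<psi>2 (?s z) * ?q - 2 * \<psi>1 (?s z) * ?t) \<le> 0"
    using pde[OF zS] by (simp add: algebra_simps)
  then have le: "\<psi>1 (?s z) * ?s z - 4 * \<psi>2 (?s z) * ?q - 2 * \<psi>1 (?s z) * ?t \<le> 0"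
    using \<epsilon> by (simp add: mult_le_0_iff)
  have \<psi>1: "\<psi>1 (?s z) > 0" using K by (simp add: \<psi>1_def add_pos_pos)
  have \<psi>1t: "\<psi>1 (?s z) * ?t \<le> \<psi>1 (?s z) * T" using trace[OF zS] \<psi>1 by simp
  show False
  proof (cases "?s z \<le> 2 * T")
    case True
    let ?e = "K * exp (- \<alpha> * ?s z)"
    have e1: "?e \<ge> 1"
    proof -
      have "?e = exp (\<alpha> * (2 * T - ?s z))"
        by (simp add: K_def exp_add[symmetric] algebra_simps)
      then show ?thesis using True \<alpha> by simp
    qed
    have "q \<le> ?q" using q(2)[OF zS dz True] .
    then have "\<alpha> * q * ?e \<le> \<alpha> * ?q * ?e" using \<alpha> e1 by (intro mult_right_mono mult_left_mono) auto
    moreover have "\<alpha> * q * ?e > T * ?e" using \<alpha> e1 by (intro mult_strict_right_mono) auto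
    moreover have "\<psi>1 (?s z) * T \<le> 2 * (T * ?e)"
    proof -
      have "T \<le> T * ?e" using e1 T by simp
      then show ?thesis by (simp add: \<psi>1_def algebra_simps)
    qed
    moreover have "- 4 * \<psi>2 (?s z) * ?q = 4 * (\<alpha> * ?q * ?e)" by (simp add: \<psi>2_def)
    moreover have "\<psi>1 (?s z) * ?s z \<ge> 0" using \<psi>1 s_nonneg[of z] by simp
    ultimately show False using le \<psi>1t by linarith
  next
    case False
    \<comment> \<open>Ellipticity applied to the negative semidefinite matrix with entries -z_k
      z_l.\<close>
    have "0 \<le> ?q"
    proof -
      have "(\<Sum>k<n. \<Sum>l<n. v k * v l * - (z k * z l)) \<le> 0" for v
      proof -
        have "(\<Sum>k<n. \<Sum>l<n. v k * v l * - (z k * z l)) = - (\<Sum>k<n. v k * z k)\<^sup>2"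
          by (simp add: power2_eq_square sum_product sum_negf mult_ac)
        then show ?thesis by simp
      qed
      from elliptic[OF zS, OF this] show ?thesis by (simp add: sum_negf)
    qed
    then have "- 4 * \<psi>2 (?s z) * ?q \<ge> 0" using \<alpha> K by (simp add: \<psi>2_def)
    moreover have "\<psi>1 (?s z) * ?s z > \<psi>1 (?s z) * (2 * T)" using \<psi>1 False by simp
    ultimately show False using le \<psi>1t by linarith
  qed
qed

subsection \<open>Rigidity of the graph\<close>

text \<open>With 4M = I + A A^T, evaluating the bilinear form of 4M on columns of Q gives 4Q = Q^T Q
  + (A^T Q)^T (A^T Q). So Q is symmetric and a sum of squares: ellipticity holds summand by summand,
  and the first sum alone yields Q_kk^2 \<le> 4 Q_kk.\<close>

lemma
  fixes A M Q :: "nat \<Rightarrow> nat \<Rightarrow> real"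
  assumes M: "\<And>i j. i < n \<Longrightarrow> j < n \<Longrightarrow> M i j = (of_bool (i = j) + (\<Sum>m<n. A i m * A j m)) / 4"
    and inverse: "\<And>i k. i < n \<Longrightarrow> k < n \<Longrightarrow> (\<Sum>j<n. M i j * Q j k) = of_bool (i = k)"
  shows gram_inverse_elliptic:
      "(\<And>v. (\<Sum>k<n. \<Sum>l<n. v k * v l * B k l) \<le> 0) \<Longrightarrow> (\<Sum>k<n. \<Sum>l<n. Q k l * B k l) \<le> 0"
    and gram_inverse_diagonal: "k < n \<Longrightarrow> Q k k \<le> 4"
    and gram_inverse_lower: "(\<Sum>i<n. \<Sum>j<n. M i j * (x i * x j)) \<le> K \<Longrightarrow> K > 0 \<Longrightarrow> d > 0 \<Longrightarrow>
      d \<le> (\<Sum>i<n. (x i)\<^sup>2) \<Longrightarrow> d\<^sup>2 / K \<le> (\<Sum>k<n. \<Sum>l<n. Q k l * (x k * x l))"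
proof -
  define P where "P = (\<lambda>k l. (\<Sum>a<n. Q a k * Q a l)
    + (\<Sum>m<n. (\<Sum>a<n. A a m * Q a k) * (\<Sum>a<n. A a m * Q a l)))"
  define form where "form = (\<lambda>v w :: nat \<Rightarrow> real. \<Sum>i<n. \<Sum>j<n. M i j * (v i * w j))"
  have form: "4 * form v w = (\<Sum>a<n. v a * w a) + (\<Sum>m<n. (\<Sum>a<n. A a m * v a) * (\<Sum>a<n. A a m * w a))"
    for v w
  proof -
    have "4 * form v w = (\<Sum>i<n. \<Sum>j<n. of_bool (i = j) * (v i * w j)
        + (\<Sum>m<n. (A i m * v i) * (A j m * w j)))"
      unfolding form_def sum_distrib_left
      by (intro sum.cong refl) (simp add: M sum_distrib_left sum_distrib_right algebra_simps)
    also have "\<dots> = (\<Sum>a<n. v a * w a) + (\<Sum>i<n. \<Sum>j<n. \<Sum>m<n. (A i m * v i) * (A j m * w j))"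
      by (simp add: sum.distrib)
    also have "(\<Sum>i<n. \<Sum>j<n. \<Sum>m<n. (A i m * v i) * (A j m * w j))
        = (\<Sum>m<n. \<Sum>i<n. \<Sum>j<n. (A i m * v i) * (A j m * w j))"
      by (subst (2) sum.swap, subst sum.swap) (rule refl)
    finally show ?thesis by (simp only: sum_product)
  qed
  have form_Q: "form v (\<lambda>j. Q j l) = v l" if "l < n" for v l
  proof -
    have "form v (\<lambda>j. Q j l) = (\<Sum>i<n. v i * (\<Sum>j<n. M i j * Q j l))"
      unfolding form_def by (simp add: sum_distrib_left mult_ac)
    also have "\<dots> = (\<Sum>i<n. v i * of_bool (i = l))" using inverse[OF _ that] by simp
    finally show ?thesis using that by simp
  qed
  have P: "P k l = 4 * Q l k" if "k < n" "l < n" for k l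
    using form[of "\<lambda>j. Q j k" "\<lambda>j. Q j l"] form_Q[OF that(2), of "\<lambda>j. Q j k"] by (simp add: P_def)
  have sym: "Q k l = Q l k" if "k < n" "l < n" for k l
    using P[of k l] P[of l k] that by (simp add: P_def mult.commute)
  have Q: "4 * Q k l = (\<Sum>a<n. Q a k * Q a l)
    + (\<Sum>m<n. (\<Sum>a<n. A a m * Q a k) * (\<Sum>a<n. A a m * Q a l))" if "k < n" "l < n" for k l
    using P[OF that] sym[OF that] by (simp add: P_def)
  have swap3: "(\<Sum>k<n. \<Sum>l<n. (\<Sum>a<n. f a k * f a l) * B k l) = (\<Sum>a<n. \<Sum>k<n. \<Sum>l<n. f a k * f a l * B k l)"
    for f B :: "nat \<Rightarrow> nat \<Rightarrow> real"
    unfolding sum_distrib_right by (subst (2) sum.swap, subst sum.swap) (rule refl)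
  show "(\<Sum>k<n. \<Sum>l<n. Q k l * B k l) \<le> 0" if neg: "\<And>v. (\<Sum>k<n. \<Sum>l<n. v k * v l * B k l) \<le> 0" for B
  proof -
    have "4 * (\<Sum>k<n. \<Sum>l<n. Q k l * B k l) = (\<Sum>k<n. \<Sum>l<n. (4 * Q k l) * B k l)"
      by (simp add: sum_distrib_left mult_ac)
    also have "\<dots> = (\<Sum>k<n. \<Sum>l<n. ((\<Sum>a<n. Q a k * Q a l)
        + (\<Sum>m<n. (\<Sum>a<n. A a m * Q a k) * (\<Sum>a<n. A a m * Q a l))) * B k l)"
      using Q by (intro sum.cong refl) auto
    also have "\<dots> = (\<Sum>k<n. \<Sum>l<n. (\<Sum>a<n. Q a k * Q a l) * B k l)
        + (\<Sum>k<n. \<Sum>l<n. (\<Sum>m<n. (\<Sum>a<n. A a m * Q a k) * (\<Sum>a<n. A a m * Q a l)) * B k l)"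
      by (simp only: distrib_right sum.distrib)
    also have "\<dots> \<le> 0"
      unfolding swap3[of Q] swap3[of "\<lambda>m k. \<Sum>a<n. A a m * Q a k"]
      by (intro add_nonpos_nonpos sum_nonpos neg)
    finally show ?thesis by simp
  qed
  show "Q k k \<le> 4" if k: "k < n" for k
  proof -
    have "(Q k k)\<^sup>2 \<le> (\<Sum>a<n. (Q a k)\<^sup>2)" using k by (intro member_le_sum) auto
    also have "\<dots> \<le> 4 * Q k k"
      unfolding Q[OF k k] by (simp add: power2_eq_square sum_nonneg)
    finally have "Q k k * Q k k \<le> 4 * Q k k" by (simp add: power2_eq_square)
    then show ?thesis by (cases "Q k k > 0") auto
  qed
  show "d\<^sup>2 / K \<le> (\<Sum>k<n. \<Sum>l<n. Q k l * (x k * x l))"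
    if xK: "(\<Sum>i<n. \<Sum>j<n. M i j * (x i * x j)) \<le> K" and K: "K > 0" and d: "d > 0"
      and dx: "d \<le> (\<Sum>i<n. (x i)\<^sup>2)" for x K d
  proof -
    let ?q = "\<Sum>k<n. \<Sum>l<n. Q k l * (x k * x l)"
    define y where "y = (\<lambda>a. \<Sum>l<n. x l * Q a l)"
    \<comment> \<open>With y = Qx, expand M(x - t y, x - t y) \<ge> 0, a form of Cauchy-Schwarz.
      This t makes t |x|^2 at least K, hence at least M(x, x), and what remains is K \<le> t^2 times
      the wanted form.\<close>
    define t where "t = K / d"
    have y: "form v y = (\<Sum>l<n. x l * v l)" for v
    proof -
      have "form v y = (\<Sum>i<n. \<Sum>j<n. \<Sum>l<n. x l * (M i j * (v i * Q j l)))"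
        unfolding form_def y_def by (simp add: sum_distrib_left mult_ac)
      also have "\<dots> = (\<Sum>l<n. x l * form v (\<lambda>j. Q j l))"
        unfolding form_def sum_distrib_left by (subst (2) sum.swap, subst sum.swap) (rule refl)
      finally show ?thesis using form_Q by simp
    qed
    have expand: "form (\<lambda>a. x a - t * y a) (\<lambda>a. x a - t * y a) = form x x - t * form x y - t * form y x + t * t * form y y"
      unfolding form_def sum_distrib_left sum_subtractf[symmetric] sum.distrib[symmetric]
      by (intro sum.cong refl) (simp add: algebra_simps)
    have yx: "form y x = form x y"
      using form[of x y] form[of y x] by (simp add: mult.commute)
    have "0 \<le> 4 * form v v" for v
      unfolding form by (intro add_nonneg_nonneg sum_nonneg) auto
    then have nonneg: "0 \<le> form (\<lambda>a. x a - t * y a) (\<lambda>a. x a - t * y a)" by simp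
    have yy: "form y y = ?q" unfolding y by (simp add: y_def sum_distrib_left mult_ac)
    have xy: "form x y = (\<Sum>i<n. (x i)\<^sup>2)" unfolding y by (simp add: power2_eq_square)
    have xx: "form x x \<le> K" using xK by (simp add: form_def)
    have "t * d \<le> t * (\<Sum>i<n. (x i)\<^sup>2)" using dx K d by (intro mult_left_mono) (auto simp: t_def)
    moreover have "t * d = K" using d by (simp add: t_def)
    ultimately have "K \<le> t * form x y" by (simp add: xy)
    moreover have "K \<le> q" if "0 \<le> a - b - b + q" "a \<le> K" "K \<le> b" for a b q :: real
      using that by linarith
    ultimately have "K \<le> t * t * ?q"
      using nonneg xx unfolding expand yx yy by blast
    then show ?thesis using K d by (simp add: t_def field_simps power2_eq_square)
  qed
qed

section \<open>The induced metric as a Gram matrix, constancy of V and linearity of Du\<close>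

context smooth_potential
begin

lemma induced_metric_index:
  assumes x: "x \<in> S" and i: "i < n" and j: "j < n"
  shows "induced_metric n u x $$ (i, j) = (of_bool (i = j) + (\<Sum>m<n. D2 i m x * D2 j m x)) / 4"
  using i j graph_is_legendrian[OF smooth x]
  by (simp add: induced_metric_def contact_metric_def tangent_components[OF x] sum.distrib)

text \<open>Four times the quadratic form of the metric is at least |v|^2, so the determinant is
  nonzero, \<open>mat_inverse\<close> returns \<open>Some\<close>, and \<open>the\<close> in
  \<open>induced_inverse\<close> yields a genuine inverse.\<close>

lemma induced_inverse_mult:
  assumes x: "x \<in> S" and i: "i < n" and k: "k < n"
  shows "(\<Sum>j<n. induced_metric n u x $$ (i, j) * induced_inverse n u x $$ (j, k)) = of_bool (i = k)"
proof -
  let ?M = "induced_metric n u x"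
  have M: "?M \<in> carrier_mat n n" by (simp add: induced_metric_def)
  have "Determinant.det ?M \<noteq> 0"
  proof
    assume "Determinant.det ?M = 0"
    then obtain v where v: "v \<in> carrier_vec n" "v \<noteq> 0\<^sub>v n" "?M *\<^sub>v v = 0\<^sub>v n"
      using det_0_iff_vec_prod_zero[OF M] by blast
    have row: "(\<Sum>j<n. ?M $$ (i, j) * v $ j) = 0" if "i < n" for i
    proof -
      have "(?M *\<^sub>v v) $ i = 0" using v that by simp
      then show ?thesis using that M v(1) by (simp add: scalar_prod_def lessThan_atLeast0)
    qed
    have "0 = 4 * (\<Sum>i<n. v $ i * (\<Sum>j<n. ?M $$ (i, j) * v $ j))" using row by simp
    also have "\<dots> = (\<Sum>i<n. \<Sum>j<n. of_bool (i = j) * (v $ i * v $ j)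
        + (\<Sum>m<n. (D2 i m x * v $ i) * (D2 j m x * v $ j)))"
      unfolding sum_distrib_left
      by (intro sum.cong refl)
        (simp add: induced_metric_index[OF x] sum_distrib_left sum_distrib_right algebra_simps)
    also have "\<dots> = (\<Sum>i<n. v $ i * v $ i) + (\<Sum>i<n. \<Sum>j<n. \<Sum>m<n. (D2 i m x * v $ i) * (D2 j m x * v $ j))"
      by (simp add: sum.distrib)
    also have "(\<Sum>i<n. \<Sum>j<n. \<Sum>m<n. (D2 i m x * v $ i) * (D2 j m x * v $ j))
        = (\<Sum>m<n. (\<Sum>i<n. D2 i m x * v $ i) * (\<Sum>i<n. D2 i m x * v $ i))"
      unfolding sum_product by (subst (2) sum.swap, subst sum.swap) (rule refl)
    finally have "(\<Sum>i<n. v $ i * v $ i) \<le> 0"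
      using sum_nonneg[of "{..<n}" "\<lambda>m. (\<Sum>i<n. D2 i m x * v $ i) * (\<Sum>i<n. D2 i m x * v $ i)"] by simp
    then have "(\<Sum>i<n. v $ i * v $ i) = 0" by (intro antisym sum_nonneg) auto
    then have "\<forall>i<n. v $ i = 0" by (subst (asm) sum_nonneg_eq_0_iff) auto
    then have "v = 0\<^sub>v n" using v(1) by (intro eq_vecI) auto
    then show False using v(2) by simp
  qed
  then have "?M \<in> Units (ring_mat TYPE(real) n ())" by (rule det_non_zero_imp_unit[OF M])
  then obtain B where B: "mat_inverse ?M = Some B"
    using mat_inverse(1)[OF M, of "()"] by (cases "mat_inverse ?M") auto
  from mat_inverse(2)[OF M this] have "?M * B = 1\<^sub>m n" "B \<in> carrier_mat n n" by auto
  then have "(?M * B) $$ (i, k) = of_bool (i = k)" using i k by (simp add: of_bool_def)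
  then show ?thesis
    using i k M \<open>B \<in> carrier_mat n n\<close> B
    by (simp add: induced_inverse_def scalar_prod_def lessThan_atLeast0)
qed

lemmas induced_inverse_elliptic =
    gram_inverse_elliptic[OF induced_metric_index induced_inverse_mult]
  and induced_inverse_diagonal =
    gram_inverse_diagonal[OF induced_metric_index induced_inverse_mult]
  and induced_inverse_lower =
    gram_inverse_lower[OF induced_metric_index induced_inverse_mult]

lemma continuous_coordinate:
  "i < n \<Longrightarrow> continuous_map (powertop_real {..<n}) euclideanreal (\<lambda>x. x i)"
  by (rule continuous_map_product_projection) simp

lemma continuous_V:
  "continuous_map (powertop_real {..<n}) euclideanreal (potential n u)"
  "i < n \<Longrightarrow> continuous_map (powertop_real {..<n}) euclideanreal (V1 i)"
  "i < n \<Longrightarrow> j < n \<Longrightarrow> continuous_map (powertop_real {..<n}) euclideanreal (V2 i j)"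
  unfolding potential_def[abs_def] V1_def[abs_def] V2_def[abs_def] divide_inverse
  by (intro continuous_map_diff continuous_map_minus continuous_map_sum continuous_map_real_mult
      continuous continuous_coordinate; simp)+

text \<open>On a compact box the form of the metric itself is bounded by some K, by continuity of
  the Hessian of u; this turns into a lower bound for its inverse. The constant depends on
  R.\<close>

lemma induced_inverse_locally_elliptic:
  assumes d: "d > 0"
  shows "\<exists>q>0. \<forall>x\<in>S. d \<le> (\<Sum>i<n. (x i)\<^sup>2) \<longrightarrow> (\<Sum>i<n. (x i)\<^sup>2) \<le> R \<longrightarrow>
      q \<le> (\<Sum>k<n. \<Sum>l<n. induced_inverse n u x $$ (k, l) * (x k * x l))"
proof -
  let ?N = "\<lambda>x. \<Sum>i<n. \<Sum>j<n. (of_bool (i = j) + (\<Sum>m<n. D2 i m x * D2 j m x)) / 4 * (x i * x j)"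
  \<comment> \<open>r \<ge> 1 gives r \<le> r^2, so |x|^2 \<le> R puts x into the box of half-width
    r.\<close>
  define r where "r = max R 1"
  have "continuous_map (powertop_real {..<n}) euclideanreal ?N"
    unfolding divide_inverse
    by (intro continuous_map_add continuous_map_sum continuous_map_real_mult
      continuous continuous_coordinate; simp)
  moreover have "r \<ge> 0" by (simp add: r_def)
  ultimately obtain z where z: "\<And>x. x \<in> {..<n} \<rightarrow>\<^sub>E {-r..r} \<Longrightarrow> ?N x \<le> ?N z"
    using continuous_attains_max_on_box[of n ?N r] by blast
  define K where "K = max 1 (?N z)"
  have K: "K > 0" by (simp add: K_def)
  have "d\<^sup>2 / K \<le> (\<Sum>k<n. \<Sum>l<n. induced_inverse n u x $$ (k, l) * (x k * x l))"
    if x: "x \<in> S" and lo: "d \<le> (\<Sum>i<n. (x i)\<^sup>2)" and hi: "(\<Sum>i<n. (x i)\<^sup>2) \<le> R" for x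
  proof (rule induced_inverse_lower[OF x _ _ x _ _ _ K d lo])
    have "\<bar>x i\<bar> \<le> r" if i: "i < n" for i
    proof -
      have "(x i)\<^sup>2 \<le> (\<Sum>i<n. (x i)\<^sup>2)" using i by (intro member_le_sum) auto
      also have "\<dots> \<le> r * 1" using hi by (simp add: r_def)
      also have "\<dots> \<le> r * r" by (intro mult_left_mono) (auto simp: r_def)
      finally have "\<bar>x i\<bar>\<^sup>2 \<le> r\<^sup>2" by (simp add: power2_eq_square)
      then show ?thesis by (rule power2_le_imp_le) (simp add: r_def)
    qed
    then have "x \<in> {..<n} \<rightarrow>\<^sub>E {-r..r}" using x unfolding PiE_iff abs_le_iff by (auto simp: minus_le_iff)
    from z[OF this] have "?N x \<le> K" by (simp add: K_def)
    then show "(\<Sum>i<n. \<Sum>j<n. induced_metric n u x $$ (i, j) * (x i * x j)) \<le> K"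
      by (simp add: induced_metric_index[OF x])
  qed auto
  then show ?thesis using d K by (intro exI[of _ "d\<^sup>2 / K"]) auto
qed

abbreviation origin :: "nat \<Rightarrow> real" where "origin \<equiv> \<lambda>i\<in>{..<n}. 0"

text \<open>The Liouville bound is applied to V and to -V, with W = 4 n \<pi> from the angle and T =
  4n from the diagonal of the inverse metric; T is positive because n \<ge> 1.\<close>

lemma potential_constant:
  assumes eq: "shrinker_equation n u" and n: "n \<ge> 1" and x: "x \<in> S"
  shows "potential n u x = potential n u origin"
proof (rule antisym)
  have bound: "\<bar>potential n u x\<bar> \<le> 4 * (real n * pi)" if "x \<in> S" for x
    using legendrian_angle_bound[of x] potential_eq_angle[OF eq that] by simp
  have elliptic: "(\<Sum>k<n. \<Sum>l<n. induced_inverse n u x $$ (k, l) * B k l) \<le> 0"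
    if x: "x \<in> S" and B: "\<And>v. (\<Sum>k<n. \<Sum>l<n. v k * v l * B k l) \<le> 0" for x B
    by (rule induced_inverse_elliptic[OF x _ _ x]) (use B in auto)
  have trace: "(\<Sum>k<n. induced_inverse n u x $$ (k, k)) \<le> 4 * real n" if x: "x \<in> S" for x
  proof -
    have "induced_inverse n u x $$ (k, k) \<le> 4" if "k < n" for k
      by (rule induced_inverse_diagonal[OF x _ _ x]) (use that in auto)
    then have "(\<Sum>k<n. induced_inverse n u x $$ (k, k)) \<le> (\<Sum>k<n. 4)" by (intro sum_mono) auto
    then show ?thesis by simp
  qed
  show "potential n u x \<le> potential n u origin"
    by (rule liouville_upper[where Q = "\<lambda>x k l. induced_inverse n u x $$ (k, l)" and ?w1.0 = V1 and ?w2.0 = V2,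
          OF continuous_V potential_derivative V1_derivative bound elliptic trace _
            induced_inverse_locally_elliptic potential_equation[OF eq] x])
      (use n in auto)
  have "- potential n u x \<le> - potential n u origin"
  proof (rule liouville_upper[where Q = "\<lambda>x k l. induced_inverse n u x $$ (k, l)" and w = "\<lambda>x. - potential n u x"
        and ?w1.0 = "\<lambda>i x. - V1 i x" and ?w2.0 = "\<lambda>i j x. - V2 i j x" and n = n,
          OF _ _ _ _ _ _ elliptic trace _ induced_inverse_locally_elliptic _ x])
    fix x assume x: "x \<in> S"
    show "\<bar>- potential n u x\<bar> \<le> 4 * (real n * pi)" using bound[OF x] by simp
    show "(\<Sum>k<n. \<Sum>l<n. induced_inverse n u x $$ (k, l) * - V2 k l x) = (\<Sum>k<n. x k * - V1 k x) / 2"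
      using potential_equation[OF eq x] by (simp add: sum_negf)
    fix i assume i: "i < n"
    show "((\<lambda>t. - potential n u (x(i := t))) has_real_derivative - V1 i x) (at (x i))"
      by (intro DERIV_minus potential_derivative x i)
    fix j assume j: "j < n"
    show "((\<lambda>t. - V1 j (x(i := t))) has_real_derivative - V2 i j x) (at (x i))"
      by (intro DERIV_minus V1_derivative x i j)
  qed (use n in \<open>auto intro!: continuous_map_minus continuous_V\<close>)
  then show "potential n u origin \<le> potential n u x" by simp
qed

text \<open>Euler's relation for functions homogeneous of degree one, read off from the vanishing of
  \<open>V1\<close>.\<close>

lemma gradient_eq:
  assumes eq: "shrinker_equation n u" and n: "n \<ge> 1" and x: "x \<in> S" and i: "i < n"
  shows "D1 i x = (\<Sum>j<n. x j * D2 i j x)"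
proof -
  have "((\<lambda>t. potential n u (x(i := t))) has_real_derivative 0) (at (x i))"
    using potential_constant[OF eq n upd_mem[OF x i]] by simp
  from DERIV_unique[OF this potential_derivative[OF x i]] show ?thesis by (simp add: V1_def)
qed

text \<open>Along a ray \<open>D u\<close> solves \<open>t \<phi>' = \<phi>\<close>, and differentiability at the origin makes it linear.\<close>

lemma gradient_linear:
  assumes eq: "shrinker_equation n u" and n: "n \<ge> 1" and x: "x \<in> S" and i: "i < n"
  shows "D1 i x = (\<Sum>j<n. x j * D2 j i origin)"
proof -
  define L where "L = (\<lambda>t. \<lambda>j\<in>{..<n}. 0 + t * x j)"
  define \<phi> where "\<phi> = (\<lambda>t. D1 i (L t))"
  define \<phi>' where "\<phi>' = (\<lambda>t. \<Sum>j<n. x j * D2 j i (L t))"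
  have LS: "L t \<in> S" for t unfolding L_def by (rule line_mem)
  have L0: "L 0 = origin" by (simp add: L_def)
  have L1: "L 1 = x" using x by (auto simp: L_def fun_eq_iff PiE_def extensional_def)
  have d\<phi>: "(\<phi> has_real_derivative \<phi>' t) (at t)" for t
    unfolding \<phi>_def \<phi>'_def L_def
    by (rule DERIV_along_line, erule continuous(3)[OF _ i], rule has_derivs(2)[OF _ _ i])
  have ode: "\<phi> t = t * \<phi>' t" for t
  proof -
    have "\<phi> t = (\<Sum>j<n. L t j * D2 i j (L t))"
      unfolding \<phi>_def by (rule gradient_eq[OF eq n LS i])
    also have "\<dots> = (\<Sum>j<n. t * (x j * D2 j i (L t)))"
    proof (intro sum.cong refl)
      fix j assume "j \<in> {..<n}"
      then show "L t j * D2 i j (L t) = t * (x j * D2 j i (L t))"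
        using D2_commute[OF LS i, of j t] by (simp add: L_def)
    qed
    finally show ?thesis by (simp add: \<phi>'_def sum_distrib_left)
  qed
  have "((\<lambda>t. \<phi> t / t) has_real_derivative 0) (at t)" if "t > 0" for t
    using DERIV_divide[OF d\<phi> DERIV_ident, of t] ode[of t] that by simp
  \<comment> \<open>The upper end 2 only serves to have t = 1 inside the interval.\<close>
  then have const: "\<phi> t / t = \<phi> 1 / 1" if "0 < t" "t < 2" for t
    using that by (intro DERIV_isconst3[of 0 2 t 1 "\<lambda>t. \<phi> t / t"]) auto
  have "((\<lambda>h. (\<phi> h - \<phi> 0) / (h - 0)) \<longlongrightarrow> \<phi>' 0) (at_right 0)"
    using d\<phi>[of 0] unfolding has_field_derivative_iff by (rule tendsto_within_subset) auto
  \<comment> \<open>The ray equation at 0 gives \<phi> 0 = 0, so the difference quotient at 0 is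
    \<phi> h / h, which is constantly \<phi> 1 for small h > 0.\<close>
  moreover have "((\<lambda>h. (\<phi> h - \<phi> 0) / (h - 0)) \<longlongrightarrow> \<phi> 1) (at_right 0)"
  proof (rule tendsto_eventually)
    have "\<forall>\<^sub>F h in at_right 0. h \<in> {0<..<2::real}"
      by (rule eventually_at_right_real) simp
    then show "\<forall>\<^sub>F h in at_right 0. (\<phi> h - \<phi> 0) / (h - 0) = \<phi> 1"
      by eventually_elim (use const ode[of 0] in auto)
  qed
  ultimately have "\<phi> 1 = \<phi>' 0" by (intro tendsto_unique[of "at_right (0::real)"]) auto
  then show ?thesis by (simp add: \<phi>_def \<phi>'_def L0 L1)
qed

lemma D2_constant:
  assumes eq: "shrinker_equation n u" and n: "n \<ge> 1" and x: "x \<in> S" and i: "i < n" and j: "j < n"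
  shows "D2 i j x = D2 i j origin"
proof -
  have "((\<lambda>t. \<Sum>k<n. (x(i := t)) k * D2 k j origin) has_real_derivative
      (\<Sum>k<n. of_bool (k = i) * D2 k j origin)) (at (x i))"
    by (intro DERIV_sum DERIV_cmult_right coordinate_derivative)
  then have "((\<lambda>t. D1 j (x(i := t))) has_real_derivative D2 i j origin) (at (x i))"
    using i gradient_linear[OF eq n upd_mem[OF x i] j] by simp
  from DERIV_unique[OF has_derivs(2)[OF x i j] this] show ?thesis .
qed

end

subsection \<open>Gaussian weights on a product of Lebesgue measures\<close>

lemma lborel_eq_scaled_vimage:
  fixes c :: real
  assumes "c \<noteq> 0" "A \<in> sets borel"
  shows "emeasure lborel A = ennreal \<bar>c\<bar> * emeasure lborel ((*) c -` A)"
proof -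
  have "emeasure lborel A = emeasure (density (distr lborel borel ((*) c)) (\<lambda>_. ennreal \<bar>c\<bar>)) A"
    by (subst lborel_distr_mult'[OF assms(1), symmetric]) (rule refl)
  also have "\<dots> = ennreal \<bar>c\<bar> * emeasure (distr lborel borel ((*) c)) A"
    using assms by (subst emeasure_density_const) auto
  also have "emeasure (distr lborel borel ((*) c)) A = emeasure lborel ((*) c -` A)"
    using assms by (subst emeasure_distr) auto
  finally show ?thesis .
qed

lemma PiM_lborel_scale:
  fixes n :: nat and r :: real
  defines "P \<equiv> \<Pi>\<^sub>M i\<in>{..<n}. (lborel :: real measure)"
  assumes r: "r > 0" and E: "E \<in> sets P"
  shows "emeasure P {x \<in> space P. (\<lambda>i\<in>{..<n}. x i / r) \<in> E} = ennreal (r ^ n) * emeasure P E"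
proof -
  interpret product_sigma_finite "\<lambda>i::nat. lborel :: real measure" ..
  let ?T = "\<lambda>x. \<lambda>i\<in>{..<n}. (1 / r) * x i"
  have T: "?T \<in> measurable P P"
    unfolding P_def by (intro measurable_restrict) measurable
  \<comment> \<open>Division by r pushes P forward to r^n times P; after rescaling it agrees with P
    on boxes, and these determine the product measure.\<close>
  let ?D = "scale_measure (ennreal ((1 / r) ^ n)) (distr P P ?T)"
  have "?D = P"
    unfolding P_def
  proof (rule PiM_eqI)
    fix A :: "nat \<Rightarrow> real set" assume A: "\<And>i. i \<in> {..<n} \<Longrightarrow> A i \<in> sets lborel"
    have "?T -` Pi\<^sub>E {..<n} A \<inter> space P = Pi\<^sub>E {..<n} (\<lambda>i. (*) (1 / r) -` A i)"
      by (auto simp: P_def space_PiM PiE_iff extensional_def)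
    then have "emeasure (distr P P ?T) (Pi\<^sub>E {..<n} A) = emeasure P (Pi\<^sub>E {..<n} (\<lambda>i. (*) (1 / r) -` A i))"
      using T A by (subst emeasure_distr) (auto simp: P_def intro!: sets_PiM_I_finite)
    also have "\<dots> = (\<Prod>i<n. emeasure lborel ((*) (1 / r) -` A i))"
      unfolding P_def
    proof (rule emeasure_PiM)
      fix i assume "i \<in> {..<n}"
      then have "A i \<in> sets borel" using A by simp
      then have "(*) (1 / r) -` A i \<inter> space borel \<in> sets borel"
        by (rule measurable_sets[rotated]) measurable
      then show "(*) (1 / r) -` A i \<in> sets lborel" by simp
    qed simp
    finally have "emeasure ?D (Pi\<^sub>E {..<n} A)
        = (\<Prod>i<n. ennreal (1 / r) * emeasure lborel ((*) (1 / r) -` A i))"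
      using r by (simp add: prod.distrib ennreal_power)
    also have "\<dots> = (\<Prod>i<n. emeasure lborel (A i))"
      using r A by (intro prod.cong refl) (subst (2) lborel_eq_scaled_vimage[of "1 / r"], auto)
    finally show "emeasure (scale_measure (ennreal ((1 / r) ^ n)) (distr (\<Pi>\<^sub>M i\<in>{..<n}. lborel) (\<Pi>\<^sub>M i\<in>{..<n}. lborel) ?T))
        (Pi\<^sub>E {..<n} A) = (\<Prod>i<n. emeasure lborel (A i))"
      by (simp add: P_def)
  qed simp_all
  then have "emeasure P E = ennreal ((1 / r) ^ n) * emeasure (distr P P ?T) E"
    by (metis emeasure_scale_measure)
  also have "emeasure (distr P P ?T) E = emeasure P {x \<in> space P. (\<lambda>i\<in>{..<n}. x i / r) \<in> E}"
    using T E by (subst emeasure_distr) (auto intro!: arg_cong[of _ _ "emeasure P"])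
  finally have "ennreal (r ^ n) * emeasure P E
      = ennreal (r ^ n) * (ennreal ((1 / r) ^ n) * emeasure P {x \<in> space P. (\<lambda>i\<in>{..<n}. x i / r) \<in> E})"
    by simp
  also have "\<dots> = ennreal (r ^ n * (1 / r) ^ n) * emeasure P {x \<in> space P. (\<lambda>i\<in>{..<n}. x i / r) \<in> E}"
    using r by (simp add: ennreal_mult mult.assoc)
  also have "r ^ n * (1 / r) ^ n = 1" using r by (simp add: power_mult_distrib[symmetric])
  finally show ?thesis by (simp only: ennreal_1 mult_1)
qed

lemma integrable_exp_neg_square:
  "integrable lborel (\<lambda>x :: real. exp (- (x\<^sup>2) / 16))"
proof -
  \<comment> \<open>Variance 8, since the exponent is -x^2 / (2 * 8).\<close>
  have "integrable lborel (normal_density 0 (sqrt 8))" by simp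
  then have "integrable lborel (\<lambda>x. sqrt (2 * pi * 8) * normal_density 0 (sqrt 8) x)"
    by (rule integrable_mult_right)
  then show ?thesis by (simp add: normal_density_def)
qed

text \<open>The integrand is dominated by a product of one-dimensional Gaussians.\<close>

lemma integrable_exp_neg_square_norm:
  fixes W :: "(nat \<Rightarrow> real) \<Rightarrow> real"
  assumes W: "W \<in> borel_measurable (\<Pi>\<^sub>M i\<in>{..<n}. lborel)"
    and le: "\<And>x. (\<Sum>i<n. (x i)\<^sup>2) / 16 \<le> W x"
  shows "integrable (\<Pi>\<^sub>M i\<in>{..<n}. lborel) (\<lambda>x. exp (- W x))"
proof (rule Bochner_Integration.integrable_bound)
  interpret product_sigma_finite "\<lambda>i::nat. lborel :: real measure" ..
  show "integrable (\<Pi>\<^sub>M i\<in>{..<n}. lborel) (\<lambda>x. \<Prod>i<n. exp (- ((x i)\<^sup>2) / 16 :: real))"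
    by (rule product_integrable_prod) (use integrable_exp_neg_square in simp_all)
  show "AE x in (\<Pi>\<^sub>M i\<in>{..<n}. lborel). norm (exp (- W x)) \<le> norm (\<Prod>i<n. exp (- ((x i)\<^sup>2) / 16))"
    using le by (simp add: exp_sum[symmetric] sum_negf sum_divide_distrib[symmetric])
qed (use W in measurable)

text \<open>A weight that is homogeneous of degree two has sublevel sets that are dilates of one another.\<close>

lemma sublevel_volume:
  fixes n :: nat and W :: "(nat \<Rightarrow> real) \<Rightarrow> real"
  defines "P \<equiv> \<Pi>\<^sub>M i\<in>{..<n}. (lborel :: real measure)"
  assumes W: "W \<in> borel_measurable P"
    and le: "\<And>x. (\<Sum>i<n. (x i)\<^sup>2) / 16 \<le> W x"
    and hom: "\<And>x r. r > 0 \<Longrightarrow> W (\<lambda>i\<in>{..<n}. x i / r) = W x / r\<^sup>2"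
    and r: "r \<ge> 1"
  shows "emeasure P {x \<in> space P. 2 * sqrt (W x) \<le> r}
    \<le> ennreal (2 * (LINT x|P. exp (- W x)) * r ^ n)"
proof -
  let ?E = "{x \<in> space P. 2 * sqrt (W x) \<le> 1}"
  have E: "?E \<in> sets P" using W by measurable
  have W_nonneg: "0 \<le> W x" for x
    using order_trans[OF _ le[of x]] by (simp add: sum_nonneg)
  have "{x \<in> space P. 2 * sqrt (W x) \<le> r} = {x \<in> space P. (\<lambda>i\<in>{..<n}. x i / r) \<in> ?E}"
  proof -
    have "sqrt (W (\<lambda>i\<in>{..<n}. x i / r)) = sqrt (W x) / r" for x
      using r hom[of r x] by (simp add: real_sqrt_divide)
    then have "2 * sqrt (W (\<lambda>i\<in>{..<n}. x i / r)) \<le> 1 \<longleftrightarrow> 2 * sqrt (W x) \<le> r" for x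
      using r by (simp only: times_divide_eq_right pos_divide_le_eq mult_1)
    then show ?thesis by (auto simp: P_def space_PiM)
  qed
  also have "emeasure P \<dots> = ennreal (r ^ n) * emeasure P ?E"
    unfolding P_def using PiM_lborel_scale[of r ?E n] E r by (simp add: P_def)
  also have "emeasure P ?E = (\<integral>\<^sup>+x. indicator ?E x \<partial>P)"
    using E by simp
  also have "\<dots> \<le> (\<integral>\<^sup>+x. ennreal (2 * exp (- W x)) \<partial>P)"
  proof (rule nn_integral_mono)
    fix x
    \<comment> \<open>On the sublevel set of radius 1, W \<le> 1/4, so exp (-W) \<ge> 3/4; this is
      the source of the factor 2 in the final constant.\<close>
    have "1 \<le> 2 * exp (- W x)" if "2 * sqrt (W x) \<le> 1"
    proof -
      have "(2 * sqrt (W x))\<^sup>2 \<le> 1\<^sup>2" using that W_nonneg[of x] by (intro power_mono) auto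
      then have "W x \<le> 1 / 4" using W_nonneg[of x] by (simp add: power_mult_distrib)
      moreover have "1 + - W x \<le> exp (- W x)" by (rule exp_ge_add_one_self)
      ultimately show ?thesis by linarith
    qed
    then show "indicator ?E x \<le> ennreal (2 * exp (- W x))"
      by (auto simp: indicator_def ennreal_le_iff[of _ 1, simplified] simp flip: ennreal_1 intro!: ennreal_leI)
  qed
  also have "\<dots> = ennreal (LINT x|P. 2 * exp (- W x))"
    using integrable_exp_neg_square_norm[OF W[unfolded P_def] le]
    by (intro nn_integral_eq_integral) (auto simp: P_def)
  finally have "emeasure P {x \<in> space P. 2 * sqrt (W x) \<le> r}
      \<le> ennreal (r ^ n) * ennreal (2 * (LINT x|P. exp (- W x)))"
    by (simp add: mult_left_mono)
  also have "\<dots> = ennreal (2 * (LINT x|P. exp (- W x)) * r ^ n)"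
    using r by (subst ennreal_mult[symmetric]) (auto simp: mult_ac)
  finally show ?thesis .
qed

subsection \<open>Volume of the graph\<close>

context smooth_potential
begin

text \<open>The contact form of the position vector is V / 2, so the subtracted V^2 / 4 is exactly
  its squared Reeb component and only the horizontal part remains.\<close>

lemma weight_fun_graph_map:
  assumes x: "x \<in> S"
  shows "weight_fun n u (graph_map n u x) = (\<Sum>i<n. (x i)\<^sup>2 + (D1 i x)\<^sup>2) / 16"
proof -
  have r: "restrict (graph_map n u x) {..<n} = x"
    using x by (auto simp: graph_map_def fun_eq_iff PiE_def extensional_def)
  have c: "contact_form n (graph_map n u x) (graph_map n u x) = potential n u x / 2"
    by (simp add: contact_form_def graph_map_components mult.commute[of "x _"])
  have s: "(\<Sum>i<n. graph_map n u x i * graph_map n u x i + graph_map n u x (n + i) * graph_map n u x (n + i))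
      = (\<Sum>i<n. (x i)\<^sup>2 + (D1 i x)\<^sup>2)"
    by (intro sum.cong refl) (simp add: graph_map_components power2_eq_square)
  show ?thesis
    unfolding weight_fun_def contact_metric_def r c s by (simp add: power2_eq_square)
qed

lemma induced_metric_constant:
  assumes "shrinker_equation n u" "n \<ge> 1" "x \<in> S"
  shows "induced_metric n u x = induced_metric n u origin"
proof (rule eq_matI)
  fix i j
  assume "i < dim_row (induced_metric n u origin)" "j < dim_col (induced_metric n u origin)"
  then have "i < n" "j < n" by (simp_all add: induced_metric_def)
  then show "induced_metric n u x $$ (i, j) = induced_metric n u origin $$ (i, j)"
    using D2_constant[OF assms]
    by (simp add: induced_metric_index[OF assms(3)] induced_metric_index[of origin])
qed (simp_all add: induced_metric_def)

text \<open>By rigidity, the volume measure of the graph is the image under a linear-plus-constant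
  map \<Gamma> of Lebesgue measure times a constant c, and the weight becomes the quadratic form W.
  Then I is c times the integral of exp (-W), and the same c multiplies the volume of the sublevel
  set.\<close>

lemma weighted_volume:
  assumes eq: "shrinker_equation n u" and n: "n \<ge> 1"
  defines "I \<equiv> LINT p:legendrian_graph n u|graph_volume n u. exp (- weight_fun n u p)"
  shows "set_integrable (graph_volume n u) (legendrian_graph n u) (\<lambda>p. exp (- weight_fun n u p))"
    and "r \<ge> 1 \<Longrightarrow> emeasure (graph_volume n u) (sublevel n u r) \<le> ennreal ((2 * \<bar>I\<bar> + 1) * r ^ n)"
proof -
  define P where "P = (\<Pi>\<^sub>M i\<in>{..<n}. (lborel :: real measure))"
  define N where "N = (\<Pi>\<^sub>M a\<in>{..<2*n+1}. (borel :: real measure))"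
  define G where "G = (\<lambda>x i. \<Sum>j<n. x j * D2 j i origin)"
  define W where "W = (\<lambda>x. (\<Sum>i<n. (x i)\<^sup>2 + (G x i)\<^sup>2) / 16)"
  define \<Gamma> where "\<Gamma> = (\<lambda>x. \<lambda>a\<in>{..<2*n+1}.
    if a < n then x a else if a < 2*n then G x (a - n) else potential n u origin)"
  \<comment> \<open>\<open>ennreal\<close> sends negative reals to 0, and \<open>max 0\<close>
    mirrors this, so the density is matched whatever the sign of the determinant.\<close>
  define c where "c = max 0 (sqrt (Determinant.det (induced_metric n u origin)))"
  define D where "D = density P (\<lambda>_. ennreal c)"
  have c: "c \<ge> 0" by (simp add: c_def)
  have spP: "space P = S" by (simp add: P_def space_PiM)
  have spD: "space D = S" by (simp add: D_def spP)
  have grad: "D1 i x = G x i" if "x \<in> S" "i < n" for x i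
    unfolding G_def by (rule gradient_linear[OF eq n that])
  have \<Gamma>: "graph_map n u x = \<Gamma> x" if x: "x \<in> S" for x
    unfolding graph_map_def \<Gamma>_def using grad[OF x] potential_constant[OF eq n x]
    by (intro restrict_ext) auto
  have \<Gamma>_components: "i < n \<Longrightarrow> \<Gamma> x i = x i" "i < n \<Longrightarrow> \<Gamma> x (n + i) = G x i"
    "\<Gamma> x (2 * n) = potential n u origin" for x i
    by (simp_all add: \<Gamma>_def)
  have weight: "weight_fun n u (\<Gamma> x) = W x" if x: "x \<in> S" for x
    using weight_fun_graph_map[OF x] grad[OF x] by (simp add: \<Gamma>[OF x] W_def)
  have coordP: "(\<lambda>x. x j) \<in> borel_measurable P" if "j < n" for j
    using measurable_component_singleton[of j "{..<n}" "\<lambda>_. lborel :: real measure"] that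
    by (simp add: P_def)
  have coordN: "(\<lambda>p. p j) \<in> borel_measurable N" if "j < 2*n+1" for j
    using measurable_component_singleton[of j "{..<2*n+1}" "\<lambda>_. borel :: real measure"] that
    by (simp add: N_def)
  have G_meas: "(\<lambda>x. G x i) \<in> borel_measurable P" for i
    unfolding G_def by (intro borel_measurable_sum borel_measurable_times coordP) auto
  have W_meas: "W \<in> borel_measurable P"
    unfolding W_def
    by (intro borel_measurable_divide borel_measurable_sum borel_measurable_add
        borel_measurable_power G_meas coordP) auto
  have \<Gamma>_meas: "\<Gamma> \<in> measurable D N"
    unfolding \<Gamma>_def N_def
  proof (rule measurable_restrict)
    fix a assume "a \<in> {..<2*n+1}"
    show "(\<lambda>x. if a < n then x a else if a < 2 * n then G x (a - n) else potential n u origin)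
        \<in> borel_measurable D"
      by (cases "a < n"; cases "a < 2 * n") (simp_all add: D_def coordP G_meas)
  qed
  have gv: "graph_volume n u = distr D N \<Gamma>"
  proof -
    have dens: "ennreal (sqrt (Determinant.det (induced_metric n u x))) = ennreal c" if "x \<in> space P" for x
      using induced_metric_constant[OF eq n, of x] that
      by (auto simp: spP c_def max_def ennreal_neg)
    have "density P (\<lambda>x. ennreal (sqrt (Determinant.det (induced_metric n u x)))) = D"
      unfolding D_def
    proof (rule density_cong)
      show "(\<lambda>x. ennreal (sqrt (Determinant.det (induced_metric n u x)))) \<in> borel_measurable P"
        using dens by (subst measurable_cong) auto
    qed (use dens in auto)
    then show ?thesis
      unfolding graph_volume_def P_def[symmetric] N_def[symmetric]
      using \<Gamma> spD by (intro distr_cong) auto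
  qed
  \<comment> \<open>F vanishes on \<open>space N\<close> exactly on the graph, because G reads only
    the first n coordinates of p. So h is a version of the integrand on all of
    \<open>space N\<close> whose measurability is evident.\<close>
  define F where "F = (\<lambda>p. (\<Sum>i<n. (p (n + i) - G p i)\<^sup>2) + (p (2 * n) - potential n u origin)\<^sup>2)"
  define h where "h = (\<lambda>p. if F p = 0 then exp (- (\<Sum>i<n. (p i)\<^sup>2 + (p (n + i))\<^sup>2) / 16) else 0)"
  have GN_meas: "(\<lambda>p. G p i) \<in> borel_measurable N" for i
    unfolding G_def by (intro borel_measurable_sum borel_measurable_times coordN) auto
  have F_meas[measurable]: "F \<in> borel_measurable N"
    unfolding F_def
    by (intro borel_measurable_add borel_measurable_sum borel_measurable_power borel_measurable_diff
        GN_meas coordN) auto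
  have [measurable]: "(\<lambda>p. \<Sum>i<n. (p i)\<^sup>2 + (p (n + i))\<^sup>2) \<in> borel_measurable N"
    by (intro borel_measurable_sum borel_measurable_add borel_measurable_power coordN) auto
  have h_meas: "h \<in> borel_measurable N" unfolding h_def by measurable
  have F_\<Gamma>: "F (\<Gamma> x) = 0" for x
  proof -
    have "G (\<Gamma> x) i = G x i" for i unfolding G_def by (intro sum.cong refl) (simp add: \<Gamma>_components)
    then show ?thesis by (simp add: F_def \<Gamma>_components)
  qed
  have h_\<Gamma>: "h (\<Gamma> x) = exp (- W x)" for x
    by (simp add: h_def F_\<Gamma> W_def \<Gamma>_components)
  have graph: "legendrian_graph n u = \<Gamma> ` S" unfolding legendrian_graph_def using \<Gamma> by auto
  have h_eq: "indicator (legendrian_graph n u) p *\<^sub>R exp (- weight_fun n u p) = h p"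
    if p: "p \<in> space N" for p
  proof (cases "p \<in> legendrian_graph n u")
    case True
    then obtain x where "x \<in> S" "p = \<Gamma> x" unfolding graph by auto
    then show ?thesis using True by (simp add: h_\<Gamma> weight)
  next
    case False
    have "F p \<noteq> 0"
    proof
      assume "F p = 0"
      then have "(\<Sum>i<n. (p (n + i) - G p i)\<^sup>2) = 0" "(p (2 * n) - potential n u origin)\<^sup>2 = 0"
        unfolding F_def by (subst (asm) add_nonneg_eq_0_iff; simp add: sum_nonneg)+
      then have F: "\<forall>i<n. p (n + i) = G p i" "p (2 * n) = potential n u origin"
        by (auto simp: sum_nonneg_eq_0_iff)
      let ?x = "restrict p {..<n}"
      have Gx: "G ?x i = G p i" for i unfolding G_def by (intro sum.cong refl) simp
      have "\<Gamma> ?x = p"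
      proof
        fix a
        consider "a < n" | i where "i < n" "a = n + i" | "a = 2 * n" | "\<not> a < 2 * n + 1"
          by (metis add_diff_inverse_nat less_Suc_eq mult_2 nat_add_left_cancel_less Suc_eq_plus1)
        then show "\<Gamma> ?x a = p a"
        proof cases
          case 4
          then show ?thesis using p by (auto simp: \<Gamma>_def N_def space_PiM PiE_def extensional_def)
        qed (use F Gx n in \<open>auto simp: \<Gamma>_def\<close>)
      qed
      moreover have "?x \<in> S" by auto
      ultimately show False using False unfolding graph by (metis imageI)
    qed
    then show ?thesis using False by (simp add: h_def)
  qed
  have W_le: "(\<Sum>i<n. (x i)\<^sup>2) / 16 \<le> W x" for x
    unfolding W_def by (intro divide_right_mono sum_mono) auto
  have W_hom: "W (\<lambda>i\<in>{..<n}. x i / r) = W x / r\<^sup>2" for x and r :: real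
  proof -
    have "G (\<lambda>i\<in>{..<n}. x i / r) i = G x i / r" for i
      unfolding G_def sum_divide_distrib by (intro sum.cong refl) simp
    then show ?thesis
      by (simp add: W_def power_divide sum_divide_distrib[symmetric] add_divide_distrib[symmetric])
  qed
  have int_P: "integrable P (\<lambda>x. exp (- W x))"
    unfolding P_def by (rule integrable_exp_neg_square_norm) (use W_meas W_le in \<open>auto simp: P_def\<close>)
  have exp_meas: "(\<lambda>x. exp (- W x)) \<in> borel_measurable P" using int_P by auto
  have "integrable D (\<lambda>x. exp (- W x))"
    unfolding D_def using int_P c exp_meas by (subst integrable_density) auto
  then have "integrable (distr D N \<Gamma>) h"
    using integrable_distr_eq[OF \<Gamma>_meas h_meas] by (simp add: h_\<Gamma>)
  then show "set_integrable (graph_volume n u) (legendrian_graph n u) (\<lambda>p. exp (- weight_fun n u p))"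
    unfolding set_integrable_def gv using h_eq
    by (subst Bochner_Integration.integrable_cong[OF refl, of _ _ h]) auto
  have I: "I = c * (LINT x|P. exp (- W x))"
  proof -
    have "I = integral\<^sup>L (distr D N \<Gamma>) h"
      unfolding I_def set_lebesgue_integral_def gv using h_eq
      by (intro Bochner_Integration.integral_cong) auto
    also have "\<dots> = (LINT x|D. exp (- W x))"
      by (simp add: integral_distr[OF \<Gamma>_meas h_meas] h_\<Gamma>)
    also have "\<dots> = c * (LINT x|P. exp (- W x))"
      unfolding D_def using c exp_meas by (subst integral_density) auto
    finally show ?thesis .
  qed
  show "emeasure (graph_volume n u) (sublevel n u r) \<le> ennreal ((2 * \<bar>I\<bar> + 1) * r ^ n)" if r: "r \<ge> 1"
  proof (cases "sublevel n u r \<in> sets N")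
    \<comment> \<open>A set outside the sigma-algebra has \<open>emeasure\<close> 0 by
      convention.\<close>
    case False
    then show ?thesis by (simp add: gv emeasure_notin_sets)
  next
    case True
    have pre: "\<Gamma> -` sublevel n u r \<inter> space D = {x \<in> space P. 2 * sqrt (W x) \<le> r}"
    proof -
      have "\<Gamma> x \<in> sublevel n u r \<longleftrightarrow> 2 * sqrt (W x) \<le> r" if "x \<in> S" for x
        using that by (simp add: sublevel_def graph weight[OF that])
      then show ?thesis by (auto simp: spD spP)
    qed
    have "emeasure (graph_volume n u) (sublevel n u r) = emeasure D {x \<in> space P. 2 * sqrt (W x) \<le> r}"
      using True \<Gamma>_meas by (simp add: gv emeasure_distr pre)
    also have "\<dots> = ennreal c * emeasure P {x \<in> space P. 2 * sqrt (W x) \<le> r}"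
      unfolding D_def using W_meas by (intro emeasure_density_const) measurable
    also have "\<dots> \<le> ennreal c * ennreal (2 * (LINT x|P. exp (- W x)) * r ^ n)"
      unfolding P_def
      by (intro mult_left_mono sublevel_volume W_hom r W_le W_meas[unfolded P_def]) auto
    also have "\<dots> = ennreal (2 * I * r ^ n)"
      using c r by (subst ennreal_mult[symmetric]) (auto simp: I mult_ac)
    also have "\<dots> \<le> ennreal ((2 * \<bar>I\<bar> + 1) * r ^ n)"
      using r by (intro ennreal_leI mult_right_mono) auto
    finally show ?thesis .
  qed
qed

end

theorem lemma3:
  shows "\<exists>C :: real \<Rightarrow> real. (\<forall>w. C w > 0) \<and>
    (\<forall>(n::nat) (u :: (nat \<Rightarrow> real) \<Rightarrow> real).
       n \<ge> 1 \<longrightarrow> smooth_Rn n u \<longrightarrow> shrinker_equation n u \<longrightarrow>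
         set_integrable (graph_volume n u) (legendrian_graph n u) (\<lambda>p. exp (- weight_fun n u p)) \<and>
         (\<forall>r\<ge>1. emeasure (graph_volume n u) (sublevel n u r)
            \<le> ennreal (C (LINT p:legendrian_graph n u|graph_volume n u. exp (- weight_fun n u p))
                        * r ^ n)))"
proof (intro exI[of _ "\<lambda>w. 2 * \<bar>w\<bar> + 1"] conjI allI impI)
  \<comment> \<open>The absolute value and the added 1 make the witness positive at every real w,
    including values that no graph attains.\<close>
  fix w :: real
  show "2 * \<bar>w\<bar> + 1 > 0" by simp
next
  fix n :: nat and u :: "(nat \<Rightarrow> real) \<Rightarrow> real"
  assume "n \<ge> 1" "smooth_Rn n u" "shrinker_equation n u"
  interpret smooth_potential n u by unfold_locales fact
  show "set_integrable (graph_volume n u) (legendrian_graph n u) (\<lambda>p. exp (- weight_fun n u p))"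
    by (rule weighted_volume(1)) fact+
  fix r :: real
  assume "r \<ge> 1"
  show "emeasure (graph_volume n u) (sublevel n u r)
      \<le> ennreal ((2 * \<bar>LINT p:legendrian_graph n u|graph_volume n u. exp (- weight_fun n u p)\<bar> + 1) * r ^ n)"
    by (rule weighted_volume(2)) fact+
qed

end
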